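(* If $G$ is a finite solvable tidy group and $N$ is a normal subgroup of $G$, then $G/N$ is tidy.
   Context: For a group $G$ and $x\in G$, let $\mathrm{Cyc}_G(x)=\{g\in G \mid \langle x,g\rangle \text{ is cyclic}\}$. The group $G$ is called tidy if $\mathrm{Cyc}_G(x)$ is a subgroup of $G$ for every $x\in G$. *)

theory Defs
  imports "HOL-Algebra.Algebra"
begin

definition Cyc :: "('a, 'b) monoid_scheme \<Rightarrow> 'a \<Rightarrow> 'a set"
  where "Cyc G x = {g \<in> carrier G. cyclic_group (subgroup_generated G {x, g})}"

definition tidy :: "('a, 'b) monoid_scheme \<Rightarrow> bool"
  where "tidy G \<longleftrightarrow> (\<forall>x \<in> carrier G. subgroup (Cyc G x) G)"

end

theory Submission
  imports Defs "HOL-Number_Theory.Cong"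
begin

text \<open>A finite solvable group has a chain of normal subgroups from \<open>{\<one>}\<close> up to \<open>N\<close> whose
consecutive quotients are elementary abelian, so it is enough to follow tidiness through one such
step: if \<open>h : G \<rightarrow> H\<close> is a surjective homomorphism of finite groups whose kernel \<open>M\<close> is abelian of
exponent \<open>p\<close>, and \<open>G\<close> is tidy, then \<open>H\<close> is tidy.  Solvability is what makes each step a
\<open>p\<close>-step of this kind.

In the step, write an element of \<open>H\<close> as a commuting product of a \<open>p\<close>-element and a \<open>p\<close>-regular
element.  The cyclicizer of the product is the intersection of the cyclicizers of the two factors,
so it suffices to show for \<open>y\<close> of either kind that \<open>Cyc H y\<close> is the image of \<open>Cyc G x\<close> for a
well-chosen preimage \<open>x\<close>.

For \<open>p\<close>-regular \<open>y\<close> take \<open>x\<close> to be \<open>p\<close>-regular.  Any cyclic subgroup of \<open>H\<close> containing \<open>y\<close> lifts to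
a cyclic subgroup of \<open>G\<close> containing a \<open>p\<close>-regular preimage of \<open>y\<close>, and all such preimages are
conjugate under \<open>M\<close> by an averaging argument (\<open>intertwiner_in_coset\<close>).

For a nontrivial \<open>p\<close>-element \<open>y\<close> with preimage \<open>x\<close>, the heart of the matter is
\<open>p_regular_commutes_if_commutes_mod_kernel\<close>: a \<open>p\<close>-regular element commuting with \<open>x\<close> modulo \<open>M\<close>
commutes with \<open>x\<close>, because it centralizes \<open>M\<close>.  Here tidiness enters in the form that an element of \<open>M\<close>
normalizes suitable cyclicizers, which meet \<open>M\<close> in at most a group of order \<open>p\<close>.  There remains the
possibility that \<open>y\<close> is a proper power of a \<open>p\<close>-element \<open>h u\<close>.  Tidiness forces the cyclic group
generated by a \<open>p\<close>-element of order greater than \<open>p\<close> to contain its whole centralizer in \<open>M\<close>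
(\<open>commuting_kernel_element_is_power\<close>); hence, if \<open>x\<close> is chosen among the preimages of \<open>y\<close> so that
its powers meet \<open>M\<close> nontrivially whenever this is possible, \<open>x\<close> is a power of \<open>u\<close>.\<close>

section \<open>Permutations of prime power order without fixed points\<close>

text \<open>Every orbit has a size that divides \<open>p ^ k\<close> and differs from \<open>1\<close>.\<close>

lemma dvd_card_if_no_fixpoint:
  fixes f :: "'a \<Rightarrow> 'a" and p :: nat
  assumes prime: "Factorial_Ring.prime p" and fin: "finite S" and maps: "f ` S \<subseteq> S"
    and per: "\<And>s. s \<in> S \<Longrightarrow> (f ^^ (p ^ k)) s = s"
    and nofix: "\<And>s. s \<in> S \<Longrightarrow> f s \<noteq> s"
  shows "p dvd card S"
proof -
  define orb where "orb s = range (\<lambda>i. (f ^^ i) s)" for s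
  have mem: "(f ^^ i) s \<in> S" if "s \<in> S" for i s
    using that maps by (induction i) auto
  have union: "\<Union>(orb ` S) = S"
  proof -
    have "s \<in> orb s" for s
      unfolding orb_def by (rule range_eqI[of _ _ 0]) simp
    then show ?thesis
      using mem unfolding orb_def by blast
  qed
  have pos: "p ^ k > 0"
    using prime by (simp add: prime_gt_0_nat)
  have per': "(f ^^ (p ^ k * j)) s = s" if "s \<in> S" for s j
    using per[OF that] by (induction j) (simp_all add: funpow_add)
  have return: "\<exists>j. (f ^^ j) ((f ^^ i) s) = s" if "s \<in> S" for s i
  proof -
    have "i \<le> p ^ k * i"
      using pos by (metis mult_le_mono1 mult_1 Suc_leI One_nat_def)
    then have "(f ^^ (p ^ k * i - i)) ((f ^^ i) s) = (f ^^ (p ^ k * i)) s"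
      by (metis comp_apply funpow_add le_add_diff_inverse2)
    then show ?thesis
      using per'[OF that] by auto
  qed
  have step: "orb ((f ^^ i) s) \<subseteq> orb s" for s i
  proof
    fix t assume "t \<in> orb ((f ^^ i) s)"
    then obtain j where "t = (f ^^ j) ((f ^^ i) s)" unfolding orb_def by blast
    then have "t = (f ^^ (j + i)) s" by (simp add: funpow_add)
    then show "t \<in> orb s" unfolding orb_def by blast
  qed
  have same: "orb t = orb s" if "s \<in> S" "t \<in> orb s" for s t
  proof -
    obtain i where t: "t = (f ^^ i) s"
      using \<open>t \<in> orb s\<close> unfolding orb_def by blast
    obtain j where "(f ^^ j) t = s"
      using return[OF \<open>s \<in> S\<close>] t by blast
    then show ?thesis
      using step[of i s] step[of j t] t by auto
  qed
  have disj: "\<forall>c1 \<in> orb ` S. \<forall>c2 \<in> orb ` S. c1 \<noteq> c2 \<longrightarrow> c1 \<inter> c2 = {}"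
  proof clarsimp
    fix s t assume st: "s \<in> S" "t \<in> S" "orb s \<noteq> orb t"
    show "orb s \<inter> orb t = {}"
    proof (rule ccontr)
      assume "orb s \<inter> orb t \<noteq> {}"
      then obtain v where "v \<in> orb s" "v \<in> orb t" by blast
      then show False using same st by metis
    qed
  qed
  have "p dvd card (orb s)" if s: "s \<in> S" for s
  proof -
    define d where "d = (LEAST d. d > 0 \<and> (f ^^ d) s = s)"
    have d: "d > 0" "(f ^^ d) s = s"
      using LeastI[of "\<lambda>d. d > 0 \<and> (f ^^ d) s = s" "p ^ k"] pos per[OF s]
      unfolding d_def by auto
    have least: "d \<le> e" if "e > 0" "(f ^^ e) s = s" for e
      unfolding d_def using that by (simp add: Least_le)
    have md: "(f ^^ (n mod d)) s = (f ^^ n) s" for n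
      by (rule funpow_mod_eq[OF d(2)])
    have "d dvd p ^ k"
    proof (rule ccontr)
      assume "\<not> d dvd p ^ k"
      then have "p ^ k mod d > 0" by (simp add: dvd_eq_mod_eq_0)
      moreover have "(f ^^ (p ^ k mod d)) s = s"
        using md per[OF s] by simp
      ultimately show False
        using least[of "p ^ k mod d"] d(1) mod_less_divisor[of d "p ^ k"] by linarith
    qed
    moreover have "d \<noteq> 1"
      using d(2) nofix[OF s] by auto
    ultimately have "p dvd d"
      using prime by (metis divides_primepow_nat dvd_triv_left power_0 not0_implies_Suc power_Suc)
    moreover have "orb s = (\<lambda>i. (f ^^ i) s) ` {..<d}"
    proof
      show "orb s \<subseteq> (\<lambda>i. (f ^^ i) s) ` {..<d}"
      proof
        fix t assume "t \<in> orb s"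
        then obtain i where "t = (f ^^ i) s" unfolding orb_def by blast
        then have "t = (f ^^ (i mod d)) s" using md by simp
        then show "t \<in> (\<lambda>i. (f ^^ i) s) ` {..<d}" using d(1) by auto
      qed
    qed (auto simp: orb_def)
    moreover have "inj_on (\<lambda>i. (f ^^ i) s) {..<d}"
    proof (rule linorder_inj_onI)
      fix i j assume ij: "i < j" "i \<in> {..<d}" "j \<in> {..<d}"
      show "(f ^^ i) s \<noteq> (f ^^ j) s"
      proof
        assume eq: "(f ^^ i) s = (f ^^ j) s"
        have "(f ^^ (d - j + i)) s = (f ^^ (d - j)) ((f ^^ j) s)"
          using eq by (simp add: funpow_add)
        also have "\<dots> = (f ^^ d) s"
          using ij by (metis comp_apply funpow_add le_add_diff_inverse2 lessThan_iff less_imp_le)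
        finally show False
          using least[of "d - j + i"] d(2) ij by auto
      qed
    qed auto
    ultimately show ?thesis
      by (simp add: card_image)
  qed
  then show ?thesis
    using dvd_partition[of "orb ` S" p] disj union fin by simp
qed

section \<open>Pairs of elements in a common cyclic subgroup\<close>

text \<open>
In a finite group this says that \<open>x\<close> and \<open>g\<close> generate a cyclic subgroup (\<open>Cyc_iff_cyc_pair\<close>);
natural exponents suffice there, and homomorphisms visibly preserve the condition.\<close>

definition cyc_pair :: "('a, 'b) monoid_scheme \<Rightarrow> 'a \<Rightarrow> 'a \<Rightarrow> bool"
  where "cyc_pair G x g \<longleftrightarrow>
    (\<exists>c \<in> carrier G. \<exists>(i :: nat) (j :: nat). x = c [^]\<^bsub>G\<^esub> i \<and> g = c [^]\<^bsub>G\<^esub> j)"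

definition p_element :: "('a, 'b) monoid_scheme \<Rightarrow> nat \<Rightarrow> 'a \<Rightarrow> bool"
  where "p_element G p x \<longleftrightarrow> x \<in> carrier G \<and> (\<exists>k. x [^]\<^bsub>G\<^esub> (p ^ k) = \<one>\<^bsub>G\<^esub>)"

text \<open>
For prime \<open>p\<close>, coprimality excludes the exponent \<open>n = 0\<close>.\<close>

definition p_regular :: "('a, 'b) monoid_scheme \<Rightarrow> nat \<Rightarrow> 'a \<Rightarrow> bool"
  where "p_regular G p x \<longleftrightarrow> x \<in> carrier G \<and> (\<exists>n. coprime n p \<and> x [^]\<^bsub>G\<^esub> n = \<one>\<^bsub>G\<^esub>)"

lemma cyc_pair_sym: "cyc_pair G x g \<Longrightarrow> cyc_pair G g x"
  unfolding cyc_pair_def by blast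

context group
begin

text \<open>Exponents of \<open>c\<close> only matter modulo any \<open>n\<close> that annihilates \<open>c\<close>; this turns the Chinese
remainder theorem and inverses modulo \<open>n\<close> into statements about powers.\<close>

lemma pow_cong:
  fixes i j n :: nat
  assumes c: "c \<in> carrier G" "c [^] n = \<one>" and ij: "[i = j] (mod n)"
  shows "c [^] i = c [^] j"
proof -
  have "c [^] i = c [^] (i mod n)" for i
  proof -
    have "c [^] i = c [^] (n * (i div n) + i mod n)" by simp
    also have "\<dots> = (c [^] n) [^] (i div n) \<otimes> c [^] (i mod n)"
      using c(1) by (simp only: nat_pow_mult[symmetric] nat_pow_pow)
    finally show ?thesis using c by simp
  qed
  then show ?thesis using ij unfolding cong_def by metis
qed

lemma commute_pows:
  fixes i j :: nat
  assumes "x \<otimes> y = y \<otimes> x" "x \<in> carrier G" "y \<in> carrier G"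
  shows "x [^] i \<otimes> y [^] j = y [^] j \<otimes> x [^] i"
  using assms by (metis group_commutes_pow nat_pow_closed)

lemma cyc_pair_closed:
  assumes "cyc_pair G x g" shows "x \<in> carrier G" "g \<in> carrier G"
  using assms unfolding cyc_pair_def by auto

lemma cyc_pair_commute: "cyc_pair G x g \<Longrightarrow> x \<otimes> g = g \<otimes> x"
  unfolding cyc_pair_def by (metis nat_pow_comm)

lemma cyc_pair_pow:
  assumes "cyc_pair G x g" shows "cyc_pair G (x [^] (i :: nat)) (g [^] (j :: nat))"
  using assms unfolding cyc_pair_def by (metis nat_pow_pow)

lemma cyc_pair_self_pow: "x \<in> carrier G \<Longrightarrow> cyc_pair G x (x [^] (j :: nat))"
  unfolding cyc_pair_def by (metis nat_pow_eone)

text \<open>The generator can be taken inside the subgroup generated by \<open>x\<close> and \<open>g\<close>, by Bezout's identity for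
the two exponents.  Consequently it inherits every commutation relation and every annihilating
exponent shared by \<open>x\<close> and \<open>g\<close>.\<close>

lemma cyc_pair_generator:
  assumes fin: "finite (carrier G)" and "cyc_pair G x g"
  obtains s t i j :: nat where
    "x = (x [^] s \<otimes> g [^] t) [^] i" "g = (x [^] s \<otimes> g [^] t) [^] j"
proof -
  obtain c and i j :: nat where c: "c \<in> carrier G" "x = c [^] i" "g = c [^] j"
    using assms(2) unfolding cyc_pair_def by blast
  define n where "n = order G"
  have n: "c [^] n = \<one>" "n > 0"
    using c fin pow_order_eq_1[OF c(1)] by (auto simp: n_def order_gt_0_iff_finite)
  have "\<exists>(s :: nat) (t :: nat). [i * s + j * t = gcd i j] (mod n)"
  proof (cases "i = 0")
    case True
    then show ?thesis by (intro exI[of _ 0] exI[of _ 1]) simp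
  next
    case False
    then obtain a b where ab: "i * a = j * b + gcd i j"
      using bezout_nat by blast
    have "j * b + j * (b * (n - 1)) = n * (j * b)"
      using n(2) by (cases n) (auto simp: algebra_simps)
    then have "i * a + j * (b * (n - 1)) = gcd i j + n * (j * b)"
      using ab by linarith
    then have "[i * a + j * (b * (n - 1)) = gcd i j] (mod n)"
      by (simp add: cong_def)
    then show ?thesis by blast
  qed
  then obtain s t :: nat where "[i * s + j * t = gcd i j] (mod n)" by blast
  then have "c [^] (i * s + j * t) = c [^] gcd i j"
    using pow_cong c(1) n(1) by blast
  then have d: "x [^] s \<otimes> g [^] t = c [^] gcd i j"
    using c by (simp add: nat_pow_pow nat_pow_mult)
  show thesis
  proof (rule that[of s t "i div gcd i j" "j div gcd i j"])
    show "x = (x [^] s \<otimes> g [^] t) [^] (i div gcd i j)" "g = (x [^] s \<otimes> g [^] t) [^] (j div gcd i j)"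
      unfolding d using c by (simp_all add: nat_pow_pow)
  qed
qed

lemma Cyc_iff_cyc_pair:
  assumes fin: "finite (carrier G)" and x: "x \<in> carrier G"
  shows "g \<in> Cyc G x \<longleftrightarrow> cyc_pair G x g"
proof
  assume "g \<in> Cyc G x"
  then have g: "g \<in> carrier G" and cy: "cyclic_group (subgroup_generated G {x, g})"
    unfolding Cyc_def by auto
  let ?K = "subgroup_generated G {x, g}"
  interpret K: group ?K by simp
  obtain c where c: "c \<in> carrier ?K" "carrier ?K = range (\<lambda>n :: int. c [^]\<^bsub>?K\<^esub> n)"
    using cy K.cyclic_group by blast
  have cG: "c \<in> carrier G"
    using c(1) carrier_subgroup_generated_subset by blast
  have "{x, g} \<subseteq> carrier ?K"
    using x g subgroup_generated_subset_carrier_subset[of "{x, g}"] by simp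
  moreover have "c [^]\<^bsub>?K\<^esub> n = c [^] n" for n :: int
    by (rule int_pow_subgroup_generated[OF c(1)])
  ultimately obtain i j :: int where ij: "x = c [^] i" "g = c [^] j"
    using c(2) by (metis (no_types, lifting) imageE insert_subset)
  have "\<exists>k :: nat. c [^] i = c [^] k" for i :: int
  proof -
    have "c [^] i = c [^] (i mod int (order G))"
    proof -
      have "c [^] i = c [^] (int (order G) * (i div int (order G)) + i mod int (order G))"
        by simp
      also have "\<dots> = (c [^] int (order G)) [^] (i div int (order G)) \<otimes> c [^] (i mod int (order G))"
        using cG by (simp only: int_pow_mult int_pow_pow)
      finally show ?thesis
        using cG pow_order_eq_1[OF cG] by (simp add: int_pow_int)
    qed
    moreover have "0 \<le> i mod int (order G)"
      using fin by (simp add: order_gt_0_iff_finite)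
    ultimately show ?thesis
      by (metis int_pow_int nonneg_int_cases)
  qed
  then show "cyc_pair G x g"
    unfolding cyc_pair_def using ij cG by metis
next
  assume cp: "cyc_pair G x g"
  then obtain s t i j :: nat where d: "x = (x [^] s \<otimes> g [^] t) [^] i" "g = (x [^] s \<otimes> g [^] t) [^] j"
    using cyc_pair_generator[OF fin] by blast
  have g: "g \<in> carrier G" using cyc_pair_closed[OF cp] by simp
  define d where "d = x [^] s \<otimes> g [^] t"
  have dG: "d \<in> carrier G" using x g d_def by simp
  have pw: "a [^] (k :: nat) \<in> H" if "a \<in> H" "subgroup H G" for a k H
    using that by (induction k) (auto simp: subgroup.one_closed subgroup.m_closed)
  have sub1: "subgroup (generate G {d}) G"
    using generate_is_subgroup dG by simp
  have sub2: "subgroup (generate G {x, g}) G"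
    using generate_is_subgroup x g by simp
  have "d [^] (k :: nat) \<in> generate G {d}" for k
    by (rule pw[OF _ sub1]) (simp add: generate.incl)
  then have "x \<in> generate G {d}" "g \<in> generate G {d}"
    using d unfolding d_def[symmetric] by metis+
  moreover have "d \<in> generate G {x, g}"
    unfolding d_def by (intro subgroup.m_closed[OF sub2] pw[OF _ sub2]) (simp_all add: generate.incl)
  ultimately have "generate G {x, g} = generate G {d}"
    using generate_subgroup_incl[OF _ sub1, of "{x, g}"] generate_subgroup_incl[OF _ sub2, of "{d}"]
    by blast
  then have "subgroup_generated G {x, g} = subgroup_generated G {d}"
    using x g dG by (simp add: subgroup_generated_def Int_absorb1)
  then show "g \<in> Cyc G x"
    unfolding Cyc_def using g cyclic_group_generated by simp
qed

section \<open>Decomposition into a p-element and a p-regular element\<close>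

lemma p_elementD: "p_element G p x \<Longrightarrow> x \<in> carrier G"
  unfolding p_element_def by blast

lemma p_regularD: "p_regular G p x \<Longrightarrow> x \<in> carrier G"
  unfolding p_regular_def by blast

lemma p_element_pow: "p_element G p x \<Longrightarrow> p_element G p (x [^] (i :: nat))"
  unfolding p_element_def by (metis mult.commute nat_pow_closed nat_pow_one nat_pow_pow)

lemma p_regular_pow: "p_regular G p x \<Longrightarrow> p_regular G p (x [^] (i :: nat))"
  unfolding p_regular_def by (metis mult.commute nat_pow_closed nat_pow_one nat_pow_pow)

lemma p_element_mult:
  assumes "p_element G p x" "p_element G p y" "x \<otimes> y = y \<otimes> x"
  shows "p_element G p (x \<otimes> y)"
proof -
  obtain k l where kl: "x [^] (p ^ k) = \<one>" "y [^] (p ^ l) = \<one>" and xy: "x \<in> carrier G" "y \<in> carrier G"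
    using assms unfolding p_element_def by blast
  have "x [^] (p ^ (k + l)) = \<one>" "y [^] (p ^ (k + l)) = \<one>"
    using kl xy by (metis nat_pow_one nat_pow_pow power_add mult.commute)+
  then have "(x \<otimes> y) [^] (p ^ (k + l)) = \<one>"
    using xy assms(3) by (simp add: pow_mult_distrib)
  then show ?thesis unfolding p_element_def using xy by blast
qed

lemma p_regular_mult:
  assumes "p_regular G p x" "p_regular G p y" "x \<otimes> y = y \<otimes> x"
  shows "p_regular G p (x \<otimes> y)"
proof -
  obtain k l where kl: "x [^] k = \<one>" "y [^] l = \<one>" "coprime k p" "coprime l p"
    and xy: "x \<in> carrier G" "y \<in> carrier G"
    using assms unfolding p_regular_def by blast
  have "x [^] (k * l) = \<one>" "y [^] (k * l) = \<one>"
    using kl xy by (metis nat_pow_one nat_pow_pow mult.commute)+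
  then have "(x \<otimes> y) [^] (k * l) = \<one>"
    using xy assms(3) by (simp add: pow_mult_distrib)
  moreover have "coprime (k * l) p" using kl by simp
  ultimately show ?thesis unfolding p_regular_def using xy by blast
qed

lemma p_element_p_regular_one:
  assumes "p_element G p x" "p_regular G p x" shows "x = \<one>"
proof -
  obtain k n where kn: "x [^] (p ^ k) = \<one>" "x [^] n = \<one>" "coprime n p" and x: "x \<in> carrier G"
    using assms unfolding p_element_def p_regular_def by blast
  have "ord x dvd p ^ k" "ord x dvd n"
    using kn x pow_eq_id by blast+
  moreover have "coprime n (p ^ k)" using kn by simp
  ultimately have "ord x = 1"
    using coprime_common_divisor_nat by blast
  then show ?thesis using ord_eq_1 x by blast
qed

lemma p_part_exponents:
  assumes "finite (carrier G)" "Factorial_Ring.prime p" "g \<in> carrier G"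
  obtains e f :: nat where "p_element G p (g [^] e)" "p_regular G p (g [^] f)" "g [^] e \<otimes> g [^] f = g"
proof -
  have "order G \<noteq> 0" using assms(1) order_gt_0_iff_finite by simp
  then obtain m k where km: "order G = p ^ k * m" "\<not> p dvd m"
    using prime_power_canonical[of p "order G"] assms(2) by (metis mult.commute neq0_conv)
  have one: "g [^] (p ^ k * m) = \<one>" using pow_order_eq_1 assms(3) km(1) by metis
  have cop: "coprime m p"
    using km(2) assms(2) by (metis coprime_commute prime_imp_coprime)
  then have cop': "coprime (p ^ k) m" by (simp add: coprime_commute)
  obtain e where e: "[e = 1] (mod p ^ k)" "[e = 0] (mod m)"
    using binary_chinese_remainder_nat[OF cop'] by blast
  obtain f where f: "[f = 0] (mod p ^ k)" "[f = 1] (mod m)"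
    using binary_chinese_remainder_nat[OF cop'] by blast
  have "[e + f = 1] (mod p ^ k)" "[e + f = 1] (mod m)"
    using cong_add[OF e(1) f(1)] cong_add[OF e(2) f(2)] by simp_all
  then have "[e + f = 1] (mod p ^ k * m)"
    using coprime_cong_mult_nat[OF _ _ cop'] by blast
  then have "g [^] e \<otimes> g [^] f = g"
    using pow_cong[OF assms(3) one] assms(3) by (metis nat_pow_eone nat_pow_mult)
  moreover have "p_element G p (g [^] e)"
  proof -
    obtain q where "e = m * q" using e(2) by (auto simp: cong_0_iff)
    then have "(g [^] e) [^] (p ^ k) = (g [^] (p ^ k * m)) [^] q"
      using assms(3) by (simp add: nat_pow_pow mult_ac)
    then show ?thesis unfolding p_element_def using one assms(3) by auto
  qed
  moreover have "p_regular G p (g [^] f)"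
  proof -
    obtain q where "f = p ^ k * q" using f(1) by (auto simp: cong_0_iff)
    then have "(g [^] f) [^] m = (g [^] (p ^ k * m)) [^] q"
      using assms(3) by (simp add: nat_pow_pow mult_ac)
    then show ?thesis unfolding p_regular_def using one assms(3) cop by auto
  qed
  ultimately show thesis using that by blast
qed

lemma commuting_parts_are_powers:
  assumes "p_element G p a" "p_regular G p b" "a \<otimes> b = b \<otimes> a"
  obtains e f :: nat where "(a \<otimes> b) [^] e = a" "(a \<otimes> b) [^] f = b"
proof -
  obtain k n where kn: "a [^] (p ^ k) = \<one>" "b [^] n = \<one>" "coprime n p"
    and ab: "a \<in> carrier G" "b \<in> carrier G"
    using assms(1,2) unfolding p_element_def p_regular_def by blast
  have cop: "coprime (p ^ k) n" using kn(3) by (simp add: coprime_commute)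
  obtain e where e: "[e = 1] (mod p ^ k)" "[e = 0] (mod n)"
    using binary_chinese_remainder_nat[OF cop] by blast
  obtain f where f: "[f = 0] (mod p ^ k)" "[f = 1] (mod n)"
    using binary_chinese_remainder_nat[OF cop] by blast
  have pw: "a [^] e = a" "b [^] e = \<one>" "a [^] f = \<one>" "b [^] f = b"
    using pow_cong[OF ab(1) kn(1) e(1)] pow_cong[OF ab(2) kn(2) e(2)]
      pow_cong[OF ab(1) kn(1) f(1)] pow_cong[OF ab(2) kn(2) f(2)] ab by simp_all
  show thesis
    by (rule that[of e f]) (simp_all add: pow_mult_distrib assms(3) ab pw)
qed

text \<open>Both pairs have generators that are words in the pair, so the two generators commute and have
coprime orders; their product generates everything.\<close>

lemma cyc_pair_combine:
  assumes fin: "finite (carrier G)"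
    and a: "p_element G p a1" "p_element G p a2" "cyc_pair G a1 a2"
    and b: "p_regular G p b1" "p_regular G p b2" "cyc_pair G b1 b2"
    and comm: "a1 \<otimes> b1 = b1 \<otimes> a1" "a1 \<otimes> b2 = b2 \<otimes> a1" "a2 \<otimes> b1 = b1 \<otimes> a2" "a2 \<otimes> b2 = b2 \<otimes> a2"
  shows "cyc_pair G (a1 \<otimes> b1) (a2 \<otimes> b2)"
proof -
  obtain s t i j :: nat where c: "a1 = (a1 [^] s \<otimes> a2 [^] t) [^] i" "a2 = (a1 [^] s \<otimes> a2 [^] t) [^] j"
    using cyc_pair_generator[OF fin a(3)] by metis
  obtain s' t' i' j' :: nat where d: "b1 = (b1 [^] s' \<otimes> b2 [^] t') [^] i'" "b2 = (b1 [^] s' \<otimes> b2 [^] t') [^] j'"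
    using cyc_pair_generator[OF fin b(3)] by metis
  define c0 where "c0 = a1 [^] s \<otimes> a2 [^] t"
  define d0 where "d0 = b1 [^] s' \<otimes> b2 [^] t'"
  note cl = p_elementD[OF a(1)] p_elementD[OF a(2)] p_regularD[OF b(1)] p_regularD[OF b(2)]
  have c0: "c0 \<in> carrier G" and d0: "d0 \<in> carrier G" using cl unfolding c0_def d0_def by auto
  have "x \<otimes> d0 = d0 \<otimes> x" if "x \<in> carrier G" "x \<otimes> b1 = b1 \<otimes> x" "x \<otimes> b2 = b2 \<otimes> x" for x
  proof -
    have "x \<otimes> b1 [^] s' = b1 [^] s' \<otimes> x" "x \<otimes> b2 [^] t' = b2 [^] t' \<otimes> x"
      using that cl commute_pows[of x b1 1 s'] commute_pows[of x b2 1 t'] by simp_all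
    then show ?thesis unfolding d0_def using that cl by (metis m_assoc nat_pow_closed)
  qed
  then have "a1 \<otimes> d0 = d0 \<otimes> a1" "a2 \<otimes> d0 = d0 \<otimes> a2" using comm cl by auto
  then have "a1 [^] s \<otimes> d0 = d0 \<otimes> a1 [^] s" "a2 [^] t \<otimes> d0 = d0 \<otimes> a2 [^] t"
    using cl d0 group_commutes_pow by blast+
  then have cd: "c0 \<otimes> d0 = d0 \<otimes> c0"
    unfolding c0_def using cl d0 by (metis m_assoc nat_pow_closed)
  have "p_element G p c0" "p_regular G p d0"
    unfolding c0_def d0_def
    using a b cyc_pair_commute[OF cyc_pair_pow[OF a(3)]] cyc_pair_commute[OF cyc_pair_pow[OF b(3)]]
    by (simp_all add: p_element_mult p_element_pow p_regular_mult p_regular_pow)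
  then obtain e f :: nat where ef: "(c0 \<otimes> d0) [^] e = c0" "(c0 \<otimes> d0) [^] f = d0"
    using commuting_parts_are_powers cd by metis
  have "a1 = (c0 \<otimes> d0) [^] (e * i)" "a2 = (c0 \<otimes> d0) [^] (e * j)"
    "b1 = (c0 \<otimes> d0) [^] (f * i')" "b2 = (c0 \<otimes> d0) [^] (f * j')"
    using c d ef c0 d0 unfolding c0_def[symmetric] d0_def[symmetric]
    by (metis m_closed nat_pow_pow)+
  then have "a1 \<otimes> b1 = (c0 \<otimes> d0) [^] (e * i + f * i')" "a2 \<otimes> b2 = (c0 \<otimes> d0) [^] (e * j + f * j')"
    using c0 d0 by (metis m_closed nat_pow_mult)+
  then show ?thesis
    unfolding cyc_pair_def using c0 d0 by (metis m_closed)
qed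

text \<open>The subgroups of a cyclic \<open>p\<close>-group form a chain, because the divisors of \<open>p ^ k\<close> do.\<close>

lemma cyc_pair_p_element_power:
  assumes fin: "finite (carrier G)" and p: "Factorial_Ring.prime p"
    and a: "p_element G p a" "p_element G p b" "cyc_pair G a b"
  shows "(\<exists>k :: nat. a = b [^] k) \<or> (\<exists>k :: nat. b = a [^] k)"
proof -
  obtain s t i j :: nat where st: "a = (a [^] s \<otimes> b [^] t) [^] i" "b = (a [^] s \<otimes> b [^] t) [^] j"
    using cyc_pair_generator[OF fin a(3)] by metis
  define c where "c = a [^] s \<otimes> b [^] t"
  have "p_element G p c"
    unfolding c_def using a cyc_pair_commute[OF cyc_pair_pow[OF a(3)]] by (simp add: p_element_mult p_element_pow)
  then obtain k where c: "c \<in> carrier G" "c [^] (p ^ k) = \<one>"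
    unfolding p_element_def by blast
  have key: "\<exists>l :: nat. c [^] j = (c [^] i) [^] l" if "gcd i (p ^ k) dvd gcd j (p ^ k)" for i j :: nat
  proof -
    obtain x where x: "[i * x = gcd i (p ^ k)] (mod p ^ k)"
      using cong_solve_nat by blast
    obtain q where q: "j = gcd i (p ^ k) * q"
      using \<open>gcd i (p ^ k) dvd gcd j (p ^ k)\<close> by (meson dvdE dvd_trans gcd_dvd1)
    have "[i * x * q = j] (mod p ^ k)"
      using cong_scalar_right[OF x, of q] q by simp
    then have "c [^] (i * (x * q)) = c [^] j"
      using pow_cong[OF c] by (simp add: mult.assoc)
    then show ?thesis using c(1) by (metis nat_pow_pow)
  qed
  obtain u v where "gcd i (p ^ k) = p ^ u" "gcd j (p ^ k) = p ^ v"
    using p by (metis divides_primepow_nat gcd_dvd2)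
  then have "gcd i (p ^ k) dvd gcd j (p ^ k) \<or> gcd j (p ^ k) dvd gcd i (p ^ k)"
    by (metis le_imp_power_dvd nle_le)
  then show ?thesis
    using key st unfolding c_def[symmetric] by metis
qed

lemma prime_order_power:
  fixes p i :: nat
  assumes "Factorial_Ring.prime p" "t \<in> carrier G" "t [^] p = \<one>" "t [^] i \<noteq> \<one>"
  obtains j :: nat where "t = (t [^] i) [^] j"
proof -
  have "\<not> p dvd i"
    using assms by (metis dvdE nat_pow_one nat_pow_pow)
  then have "coprime i p"
    using assms(1) by (metis coprime_commute prime_imp_coprime)
  then obtain j where "[i * j = 1] (mod p)"
    using cong_solve_coprime_nat by fastforce
  then have "t [^] (i * j) = t [^] (1 :: nat)" using pow_cong assms by blast
  then show thesis using that[of j] assms by (simp add: nat_pow_pow)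
qed

lemma inv_cancel:
  assumes "x \<in> carrier G" "y \<in> carrier G"
  shows "inv x \<otimes> (x \<otimes> y) = y" "x \<otimes> (inv x \<otimes> y) = y"
  using assms by (simp_all add: m_assoc[symmetric])

lemma conj_mult:
  assumes "a \<in> carrier G" "c \<in> carrier G" "b \<in> carrier G"
  shows "inv b \<otimes> (a \<otimes> c) \<otimes> b = (inv b \<otimes> a \<otimes> b) \<otimes> (inv b \<otimes> c \<otimes> b)"
  using assms by (simp add: m_assoc inv_cancel)

lemma conj_pow:
  assumes "a \<in> carrier G" "b \<in> carrier G"
  shows "inv b \<otimes> a [^] (n :: nat) \<otimes> b = (inv b \<otimes> a \<otimes> b) [^] n"
proof (induction n)
  case (Suc n)
  then show ?case using assms by (simp add: conj_mult)
qed (use assms in simp)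

lemma cyc_pair_conj:
  assumes "cyc_pair G x g" "z \<in> carrier G"
  shows "cyc_pair G (inv z \<otimes> x \<otimes> z) (inv z \<otimes> g \<otimes> z)"
proof -
  obtain c and i j :: nat where c: "c \<in> carrier G" "x = c [^] i" "g = c [^] j"
    using assms(1) unfolding cyc_pair_def by blast
  then show ?thesis
    unfolding cyc_pair_def using conj_pow assms(2) by (metis inv_closed m_closed)
qed

lemma cyc_pair_tidy:
  assumes "finite (carrier G)" "tidy G" "cyc_pair G t y" "cyc_pair G t z"
  shows "cyc_pair G t (y \<otimes> z)" "cyc_pair G t (inv y)"
proof -
  have t: "t \<in> carrier G" using cyc_pair_closed assms(3) by blast
  then have "subgroup (Cyc G t) G" using assms(2) unfolding tidy_def by blast
  then show "cyc_pair G t (y \<otimes> z)" "cyc_pair G t (inv y)"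
    using Cyc_iff_cyc_pair[OF assms(1) t] assms(3,4) subgroup.m_closed subgroup.m_inv_closed by metis+
qed

lemma p_regular_one: "p_regular G p \<one>"
  unfolding p_regular_def by (auto intro: exI[of _ 1])

lemma cyc_pair_p_element_p_regular:
  assumes "p_element G p a" "p_regular G p b" "a \<otimes> b = b \<otimes> a"
  shows "cyc_pair G a b"
proof -
  obtain e f :: nat where "(a \<otimes> b) [^] e = a" "(a \<otimes> b) [^] f = b"
    using commuting_parts_are_powers[OF assms] by blast
  then show ?thesis
    unfolding cyc_pair_def using p_elementD[OF assms(1)] p_regularD[OF assms(2)] by (metis m_closed)
qed

text \<open>This reduces cyclicizers of arbitrary elements to those of \<open>p\<close>-elements and \<open>p\<close>-regular
elements.\<close>

lemma cyc_pair_parts_iff: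
  assumes fin: "finite (carrier G)" and p: "Factorial_Ring.prime p"
    and ab: "p_element G p a" "p_regular G p b" "a \<otimes> b = b \<otimes> a"
  shows "cyc_pair G (a \<otimes> b) g \<longleftrightarrow> cyc_pair G a g \<and> cyc_pair G b g"
proof
  assume l: "cyc_pair G (a \<otimes> b) g"
  obtain e f :: nat where ef: "(a \<otimes> b) [^] e = a" "(a \<otimes> b) [^] f = b"
    using commuting_parts_are_powers[OF ab] by blast
  have "g [^] (1 :: nat) = g" using cyc_pair_closed[OF l] by simp
  then show "cyc_pair G a g \<and> cyc_pair G b g"
    using cyc_pair_pow[OF l, of e 1] cyc_pair_pow[OF l, of f 1] ef by simp
next
  assume r: "cyc_pair G a g \<and> cyc_pair G b g"
  note cl = p_elementD[OF ab(1)] p_regularD[OF ab(2)]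
  have g: "g \<in> carrier G" using cyc_pair_closed r by blast
  obtain e f :: nat where ef: "p_element G p (g [^] e)" "p_regular G p (g [^] f)" "g [^] e \<otimes> g [^] f = g"
    using p_part_exponents[OF fin p g] by metis
  have "cyc_pair G a (g [^] i)" "cyc_pair G b (g [^] i)" for i :: nat
    using cyc_pair_pow[of a g 1 i] cyc_pair_pow[of b g 1 i] r cl by simp_all
  note pows = this
  have "cyc_pair G (a \<otimes> b) (g [^] e \<otimes> g [^] f)"
    by (rule cyc_pair_combine[OF fin ab(1) ef(1) pows(1) ab(2) ef(2) pows(2) ab(3)])
      (use cyc_pair_commute[OF pows(1)] cyc_pair_commute[OF pows(2)] nat_pow_comm[OF g] in metis)+
  then show "cyc_pair G (a \<otimes> b) g" using ef(3) by simp
qed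

end

section \<open>Extensions by an abelian group of exponent p\<close>

text \<open>
The quotient by \<open>M\<close> is given as the target of a surjective homomorphism, so that the results apply
both to \<open>G \<rightarrow> G Mod {\<one>}\<close> and to \<open>G Mod A \<rightarrow> G Mod B\<close> without identifying iterated quotients.\<close>

locale tidy_extension = group_hom +
  fixes p :: nat
  assumes fin: "finite (carrier G)" and tidy: "tidy G"
    and prime: "Factorial_Ring.prime p"
    and surj: "h ` carrier G = carrier H"
    and ker_comm: "\<lbrakk>a \<in> kernel G H h; b \<in> kernel G H h\<rbrakk> \<Longrightarrow> a \<otimes> b = b \<otimes> a"
    and ker_exp: "a \<in> kernel G H h \<Longrightarrow> a [^] p = \<one>"
begin

abbreviation M where "M \<equiv> kernel G H h"

lemma M_iff: "a \<in> M \<longleftrightarrow> a \<in> carrier G \<and> h a = \<one>\<^bsub>H\<^esub>"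
  unfolding kernel_def by blast

lemma M_carrier: "a \<in> M \<Longrightarrow> a \<in> carrier G"
  unfolding kernel_def by blast

lemma M_mult: "a \<in> M \<Longrightarrow> b \<in> M \<Longrightarrow> a \<otimes> b \<in> M"
  by (simp add: M_iff)

lemma M_pow: "a \<in> M \<Longrightarrow> a [^] (n :: nat) \<in> M"
  by (simp add: M_iff hom_nat_pow)

lemma M_conj: "a \<in> M \<Longrightarrow> b \<in> carrier G \<Longrightarrow> inv b \<otimes> a \<otimes> b \<in> M"
  by (simp add: M_iff)

lemma M_one: "\<one> \<in> M"
  by (simp add: M_iff)

lemma M_interchange:
  assumes "a \<in> M" "b \<in> M" "c \<in> M" "d \<in> M"
  shows "(a \<otimes> b) \<otimes> (c \<otimes> d) = (a \<otimes> c) \<otimes> (d \<otimes> b)"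
proof -
  have "b \<otimes> (c \<otimes> d) = (c \<otimes> d) \<otimes> b"
    using ker_comm[OF assms(2) M_mult[OF assms(3,4)]] .
  then show ?thesis using assms[THEN M_carrier] by (simp add: G.m_assoc)
qed

text \<open>The map \<open>u \<mapsto> inv a \<otimes> u \<otimes> b\<close> preserves the coset of \<open>w\<close> modulo \<open>M\<close>, and its \<open>n\<close>-th power is the
identity.  It acts on the coset by affine maps of \<open>M\<close>, so averaging over its \<open>n\<close> powers gives a
fixed point; dividing by \<open>n\<close> is possible because \<open>n\<close> is invertible modulo the exponent \<open>p\<close> of \<open>M\<close>.

Taking \<open>a = b\<close> yields an element of a coset that commutes with \<open>a\<close>; taking \<open>w = \<one>\<close> yields the
conjugacy under \<open>M\<close> of two \<open>p\<close>-regular elements with the same image.\<close>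

lemma intertwiner_in_coset:
  assumes n: "coprime n p" "a [^] n = \<one>" "b [^] n = \<one>"
    and cl: "a \<in> carrier G" "b \<in> carrier G" "w \<in> carrier G"
    and eq: "h (a \<otimes> w) = h (w \<otimes> b)"
  obtains m where "m \<in> M" "a \<otimes> (w \<otimes> m) = (w \<otimes> m) \<otimes> b"
proof -
  \<comment> \<open>The cocycle of the affine action: \<open>c i\<close> is the displacement of \<open>w\<close> under its \<open>i\<close>-th power,
    and \<open>\<phi>\<close> is the linear part.\<close>
  define c where "c i = inv w \<otimes> inv (a [^] i) \<otimes> w \<otimes> b [^] i" for i :: nat
  define \<phi> where "\<phi> u = inv b \<otimes> u \<otimes> b" for u
  have hpow: "h (a [^] i \<otimes> w) = h (w \<otimes> b [^] i)" for i :: nat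
  proof (induction i)
    case (Suc i)
    have "h (a [^] Suc i \<otimes> w) = h (a [^] i) \<otimes>\<^bsub>H\<^esub> h (a \<otimes> w)"
      using cl by (simp add: H.m_assoc)
    also have "\<dots> = h (a [^] i \<otimes> w) \<otimes>\<^bsub>H\<^esub> h b"
      unfolding eq using cl by (simp add: H.m_assoc)
    also have "\<dots> = h (w \<otimes> b [^] Suc i)"
      unfolding Suc using cl by (simp add: H.m_assoc)
    finally show ?case .
  qed (use cl in simp)
  have cM: "c i \<in> M" for i
  proof -
    have "h (c i) = inv\<^bsub>H\<^esub> h (a [^] i \<otimes> w) \<otimes>\<^bsub>H\<^esub> h (w \<otimes> b [^] i)"
      using cl by (simp add: c_def H.m_assoc H.inv_mult_group)
    then show ?thesis unfolding M_iff using cl by (simp only: hpow) (simp add: c_def)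
  qed
  have \<phi>M: "\<phi> u \<in> M" if "u \<in> M" for u
    unfolding \<phi>_def using M_conj that cl by blast
  have c0: "c 0 = \<one>" and cn: "c n = \<one>"
    using cl n by (simp_all add: c_def)
  have cSuc: "c (Suc i) = c 1 \<otimes> \<phi> (c i)" for i
  proof -
    have "a [^] Suc i = a [^] i \<otimes> a" "b [^] Suc i = b [^] i \<otimes> b" by simp_all
    then show ?thesis
      using cl by (simp add: c_def \<phi>_def G.m_assoc G.inv_cancel G.inv_mult_group)
  qed
  \<comment> \<open>The witness is the product of the \<open>c i\<close> with \<open>i < j\<close>; for \<open>j = n\<close> it changes under \<open>\<phi>\<close> by the
    \<open>n\<close>-th power of \<open>c 1\<close>, so a power of it with exponent inverse to \<open>n\<close> corrects \<open>w\<close>.\<close>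
  have "\<exists>s \<in> M. \<phi> s \<otimes> c 1 [^] j = s \<otimes> c j" for j
  proof (induction j)
    case 0
    show ?case using cl c0 M_one by (intro bexI[of _ \<one>]) (simp_all add: \<phi>_def)
  next
    case (Suc j)
    then obtain s where s: "s \<in> M" "\<phi> s \<otimes> c 1 [^] j = s \<otimes> c j" by blast
    have "\<phi> (s \<otimes> c j) \<otimes> c 1 [^] Suc j = (\<phi> s \<otimes> \<phi> (c j)) \<otimes> (c 1 [^] j \<otimes> c 1)"
      using G.conj_mult s(1) cM cl M_carrier unfolding \<phi>_def by simp
    also have "\<dots> = (\<phi> s \<otimes> c 1 [^] j) \<otimes> (c 1 \<otimes> \<phi> (c j))"
      by (rule M_interchange[OF \<phi>M[OF s(1)] \<phi>M[OF cM] M_pow[OF cM] cM])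
    also have "\<dots> = (s \<otimes> c j) \<otimes> c (Suc j)"
      by (simp only: s(2) cSuc[of j, symmetric])
    finally show ?case using s(1) cM M_mult by blast
  qed
  then obtain s where s: "s \<in> M" "\<phi> s \<otimes> c 1 [^] n = s"
    using cn M_carrier by (metis G.r_one)
  obtain k where k: "[n * k = 1] (mod p)"
    using cong_solve_coprime_nat n(1) by fastforce
  have "(\<phi> s \<otimes> c 1 [^] n) [^] k = \<phi> s [^] k \<otimes> (c 1 [^] n) [^] k"
    using \<phi>M s(1) cM M_pow ker_comm M_carrier G.pow_mult_distrib by metis
  moreover have "(c 1 [^] n) [^] k = c 1"
    using G.pow_cong[OF M_carrier[OF cM] ker_exp[OF cM] k] M_carrier[OF cM] by (simp add: G.nat_pow_pow)
  moreover have "\<phi> s [^] k = \<phi> (s [^] k)"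
    unfolding \<phi>_def using G.conj_pow s(1) cl M_carrier by simp
  ultimately have m: "\<phi> (s [^] k) \<otimes> c 1 = s [^] k"
    using s(2) by simp
  define m where "m = s [^] k"
  have mM: "m \<in> M" using s(1) M_pow m_def by simp
  have "c 1 \<otimes> \<phi> m = m"
    using m ker_comm[OF cM \<phi>M[OF mM]] m_def by simp
  then have "a \<otimes> (w \<otimes> m) = a \<otimes> (w \<otimes> (c 1 \<otimes> \<phi> m))" by simp
  also have "\<dots> = (w \<otimes> m) \<otimes> b"
    using cl M_carrier[OF mM] by (simp add: c_def \<phi>_def G.m_assoc G.inv_cancel)
  finally show thesis using that mM by blast
qed

lemma p_element_M: "a \<in> M \<Longrightarrow> p_element G p a"
  unfolding p_element_def using ker_exp M_carrier by (metis power_one_right)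

lemma lift_p_element:
  assumes "x \<in> carrier G" "p_element H p (h x)" shows "p_element G p x"
proof -
  obtain k where "h x [^]\<^bsub>H\<^esub> (p ^ k) = \<one>\<^bsub>H\<^esub>"
    using assms(2) unfolding p_element_def by blast
  then have "x [^] (p ^ k) \<in> M"
    using assms(1) by (simp add: M_iff hom_nat_pow)
  then have "(x [^] (p ^ k)) [^] p = \<one>" by (rule ker_exp)
  then have "x [^] (p ^ Suc k) = \<one>"
    using assms(1) by (simp add: G.nat_pow_pow mult.commute)
  then show ?thesis unfolding p_element_def using assms(1) by blast
qed

lemma p_element_hom: "p_element G p x \<Longrightarrow> p_element H p (h x)"
  unfolding p_element_def by (metis hom_closed hom_nat_pow hom_one)

lemma cyc_pair_hom: "cyc_pair G x g \<Longrightarrow> cyc_pair H (h x) (h g)"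
  unfolding cyc_pair_def by (metis hom_closed hom_nat_pow)

lemma mem_powers_if_order_p:
  assumes "z \<in> M" "z \<noteq> \<one>" "t \<in> M" "cyc_pair G z t"
  obtains i :: nat where "t = z [^] i"
proof -
  consider (1) k :: nat where "z = t [^] k" | (2) k :: nat where "t = z [^] k"
    using G.cyc_pair_p_element_power[OF fin prime p_element_M p_element_M] assms by blast
  then show thesis
  proof cases
    case 1
    then show thesis
      using G.prime_order_power[OF prime M_carrier[OF assms(3)] ker_exp[OF assms(3)]] assms(2) that by metis
  qed (use that in blast)
qed

text \<open>Let \<open>t\<close> be a power of \<open>u\<close> of order \<open>p\<close>.  Since \<open>m\<close> has order dividing \<open>p\<close> and commutes with \<open>u\<close>, the
element \<open>t\<close> is also a power of \<open>u \<otimes> m\<close>: the exponent producing \<open>t\<close> is divisible by \<open>p\<close> and kills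
\<open>m\<close>.  So \<open>u\<close> and \<open>u \<otimes> m\<close> lie in the cyclicizer of \<open>t\<close>, and by tidiness so does \<open>m\<close>.\<close>

lemma commuting_kernel_element_is_power:
  assumes u: "p_element G p u" "u [^] p \<noteq> \<one>" and m: "m \<in> M" "u \<otimes> m = m \<otimes> u"
  obtains i :: nat where "m = u [^] i"
proof -
  have uG: "u \<in> carrier G" and mG: "m \<in> carrier G" using u(1) m(1) G.p_elementD M_carrier by auto
  define K where "K = (LEAST k. u [^] (p ^ k) = \<one>)"
  have K: "u [^] (p ^ K) = \<one>"
    unfolding K_def by (rule LeastI_ex) (use u(1) in \<open>simp add: p_element_def\<close>)
  have "u \<noteq> \<one>" using u(2) by auto
  then have "K \<noteq> 0" using K uG by (intro notI) simp
  moreover have "K \<noteq> 1" using K u(2) by (intro notI) simp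
  ultimately obtain k where k: "K = Suc k" "k > 0" by (cases K) auto
  define t where "t = u [^] (p ^ k)"
  have tG: "t \<in> carrier G" using uG t_def by simp
  have t1: "t \<noteq> \<one>"
    unfolding t_def using k not_less_Least[of k "\<lambda>k. u [^] (p ^ k) = \<one>"] unfolding K_def by simp
  have tp: "t [^] p = \<one>"
    using K uG unfolding t_def k by (simp add: G.nat_pow_pow mult.commute)
  have "m [^] (p ^ k) = \<one>"
  proof -
    obtain j where "k = Suc j" using k(2) by (cases k) auto
    then have "m [^] (p ^ k) = (m [^] p) [^] (p ^ j)" using mG by (simp add: G.nat_pow_pow)
    then show ?thesis using ker_exp[OF m(1)] by simp
  qed
  then have tum: "t = (u \<otimes> m) [^] (p ^ k)"
    using uG mG m(2) unfolding t_def by (simp add: G.pow_mult_distrib)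
  have tu: "cyc_pair G t u"
    unfolding t_def by (rule cyc_pair_sym[OF G.cyc_pair_self_pow[OF uG]])
  have "cyc_pair G t (u \<otimes> m)"
    unfolding tum by (rule cyc_pair_sym[OF G.cyc_pair_self_pow]) (use uG mG in simp)
  then have "cyc_pair G t (inv u \<otimes> (u \<otimes> m))"
    using G.cyc_pair_tidy[OF fin tidy] tu by blast
  then have tm: "cyc_pair G t m" using uG mG by (simp add: G.inv_cancel)
  have "p_element G p t" unfolding t_def using u(1) G.p_element_pow by blast
  then consider (1) i :: nat where "t = m [^] i" | (2) i :: nat where "m = t [^] i"
    using G.cyc_pair_p_element_power[OF fin prime _ p_element_M[OF m(1)] tm] by blast
  then show thesis
  proof cases
    case 1
    then obtain j :: nat where "m = t [^] j"
      using G.prime_order_power[OF prime mG ker_exp[OF m(1)]] t1 by metis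
    then show thesis using that uG unfolding t_def by (simp add: G.nat_pow_pow)
  next
    case 2
    then show thesis using that uG unfolding t_def by (simp add: G.nat_pow_pow)
  qed
qed

text \<open>If \<open>u\<close> had order \<open>p\<close>, it would be a power of each of its nontrivial powers, hence an
element of \<open>M\<close>.\<close>

lemma pow_p_ne_one_if_meets_kernel:
  assumes "p_element G p u" "u \<notin> M" "u [^] (i :: nat) \<in> M" "u [^] i \<noteq> \<one>"
  shows "u [^] p \<noteq> \<one>"
proof
  assume "u [^] p = \<one>"
  then obtain j where "u = (u [^] i) [^] (j :: nat)"
    by (rule G.prime_order_power[OF prime G.p_elementD[OF assms(1)] _ assms(4)])
  then show False using M_pow assms(2,3) by metis
qed

text \<open>A \<open>p\<close>-group acting on a nontrivial \<open>p\<close>-group has a nontrivial fixed point.  Translation by a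
nontrivial element shows that \<open>p\<close> divides \<open>card M\<close>, hence \<open>p\<close> does not divide \<open>card (M - {\<one>})\<close>,
and conjugation by \<open>x\<close> cannot be fixed-point free there.\<close>

lemma nontrivial_kernel_centralizer:
  assumes x: "p_element G p x" and M: "M \<noteq> {\<one>}"
  obtains z where "z \<in> M" "z \<noteq> \<one>" "x \<otimes> z = z \<otimes> x"
proof -
  have finM: "finite M"
    by (rule finite_subset[OF _ fin]) (auto simp: M_carrier)
  obtain m where m: "m \<in> M" "m \<noteq> \<one>" using M M_one by blast
  have "((\<lambda>u. u \<otimes> m) ^^ i) s = s \<otimes> m [^] i" if "s \<in> M" for s i
    using that m(1) by (induction i) (simp_all add: G.m_assoc M_carrier)
  then have "p dvd card M"
    using m by (intro dvd_card_if_no_fixpoint[OF prime finM, of "\<lambda>u. u \<otimes> m" 1])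
      (auto simp: ker_exp M_carrier M_mult)
  moreover have "card M \<noteq> 0" using finM M_one by auto
  ultimately have nd: "\<not> p dvd card (M - {\<one>})"
    using prime finM M_one
    by (metis One_nat_def Suc_pred card_Diff_singleton dvd_diff_nat diff_diff_cancel
        not_prime_unit diff_le_self le_eq_less_or_eq Suc_leI neq0_conv)
  obtain k where k: "x [^] (p ^ k) = \<one>" and xG: "x \<in> carrier G"
    using x unfolding p_element_def by blast
  define f where "f u = inv x \<otimes> u \<otimes> x" for u
  have it: "(f ^^ i) u = inv (x [^] i) \<otimes> u \<otimes> x [^] i" if "u \<in> carrier G" for u i
  proof (induction i)
    case (Suc i)
    have "inv (x [^] Suc i) = inv x \<otimes> inv (x [^] i)" using xG by (simp add: G.inv_mult_group)
    then show ?case using Suc that xG by (simp add: f_def G.m_assoc)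
  qed (use that in simp)
  have "f u \<noteq> \<one>" if "u \<in> M" "u \<noteq> \<one>" for u
  proof
    assume "f u = \<one>"
    then have "x \<otimes> (f u) \<otimes> inv x = \<one>" using xG by simp
    then show False using that xG M_carrier unfolding f_def by (simp add: G.m_assoc G.inv_cancel)
  qed
  then have "f ` (M - {\<one>}) \<subseteq> M - {\<one>}"
    using M_conj xG unfolding f_def by auto
  moreover have "(f ^^ (p ^ k)) u = u" if "u \<in> M - {\<one>}" for u
    using it[of u "p ^ k"] that k M_carrier by simp
  ultimately obtain z where z: "z \<in> M - {\<one>}" "f z = z"
    using dvd_card_if_no_fixpoint[OF prime, of "M - {\<one>}" f k] nd finM by auto
  have "x \<otimes> f z = z \<otimes> x"
    using z(1) xG M_carrier unfolding f_def by (simp add: G.m_assoc G.inv_cancel)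
  then show thesis using that z by auto
qed

text \<open>By averaging, \<open>r\<close> commutes with some \<open>w\<close> in the coset of \<open>x\<close>, and it is enough that \<open>r\<close> centralizes
\<open>M\<close>.  Let \<open>z \<in> M\<close> be nontrivial and commute with \<open>w\<close>.

First, \<open>r\<close> commutes with \<open>z\<close>.  If powers of \<open>w\<close> meet \<open>M\<close> nontrivially, then \<open>z\<close> is a power of \<open>w\<close>.
Otherwise the cyclicizer of \<open>w\<close> meets \<open>M\<close> trivially; it contains \<open>r\<close> and is normalized by \<open>z\<close>, so the
commutator of \<open>r\<close> and \<open>z\<close> lies in it and in \<open>M\<close>.

Second, \<open>r\<close> therefore lies in the cyclicizer of \<open>z\<close>, which is normalized by the abelian group \<open>M\<close>
and meets \<open>M\<close> in the powers of \<open>z\<close>.  So the commutator of \<open>r\<close> with any element of \<open>M\<close> is a power of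
\<open>z\<close> and commutes with \<open>r\<close>; as \<open>r\<close> is \<open>p\<close>-regular and the commutator has order dividing \<open>p\<close>, the
commutator is trivial.\<close>

lemma p_regular_commutes_if_commutes_mod_kernel:
  assumes x: "p_element G p x" "x \<notin> M" and r: "p_regular G p r"
    and eq: "h (r \<otimes> x) = h (x \<otimes> r)"
  shows "r \<otimes> x = x \<otimes> r"
proof -
  have xG: "x \<in> carrier G" and rG: "r \<in> carrier G"
    using x r G.p_elementD G.p_regularD by auto
  obtain n where n: "coprime n p" "r [^] n = \<one>" using r unfolding p_regular_def by blast
  obtain m where m: "m \<in> M" "r \<otimes> (x \<otimes> m) = (x \<otimes> m) \<otimes> r"
    using intertwiner_in_coset[OF n(1,2,2) rG rG xG eq] by blast
  have mG: "m \<in> carrier G" using m M_carrier by blast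
  define w where "w = x \<otimes> m"
  have wG: "w \<in> carrier G" and rw: "r \<otimes> w = w \<otimes> r" using m xG mG w_def by auto
  have hw: "h w = h x" using m xG unfolding w_def by (simp add: M_iff)
  have w: "p_element G p w"
    using lift_p_element[OF wG] p_element_hom[OF x(1)] hw by simp
  have wM: "w \<notin> M" using hw x(2) xG wG by (simp add: M_iff)
  have rm': "r \<otimes> m' = m' \<otimes> r" if m': "m' \<in> M" for m'
  proof (cases "M = {\<one>}")
    case True
    then show ?thesis using that rG by simp
  next
    case False
    obtain z where z: "z \<in> M" "z \<noteq> \<one>" "w \<otimes> z = z \<otimes> w"
      using nontrivial_kernel_centralizer[OF w False] by blast
    have zG: "z \<in> carrier G" using z M_carrier by blast
    have m'G: "m' \<in> carrier G" using m' M_carrier by blast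
    \<comment> \<open>A commutator \<open>t\<close> of \<open>r\<close> with \<open>v\<close> that commutes with \<open>r\<close> is \<open>p\<close>-regular, as
      \<open>r \<otimes> t\<close> is conjugate to \<open>r\<close>; but every element of \<open>M\<close> has order \<open>1\<close> or \<open>p\<close>.\<close>
    have comm: "t = \<one>" if "r \<otimes> t = inv v \<otimes> r \<otimes> v" "t \<in> M" "r \<otimes> t = t \<otimes> r" "v \<in> carrier G" for t v
    proof -
      have tG: "t \<in> carrier G" using that M_carrier by blast
      have "(r \<otimes> t) [^] n = inv v \<otimes> r [^] n \<otimes> v"
        unfolding that(1) using G.conj_pow rG that(4) by simp
      then have "(r \<otimes> t) [^] n = \<one>" using n that(4) by simp
      then have "t [^] n = \<one>" using n(2) that(3) rG tG by (simp add: G.pow_mult_distrib)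
      then have "p_regular G p t" unfolding p_regular_def using n tG by blast
      then show ?thesis using G.p_element_p_regular_one p_element_M that(2) by blast
    qed
    have conj: "inv r \<otimes> (inv v \<otimes> r \<otimes> v) \<in> M" if "v \<in> M" for v
      using that rG by (simp add: M_iff)
    have rz: "r \<otimes> z = z \<otimes> r"
    proof (cases "\<exists>i :: nat. w [^] i \<in> M \<and> w [^] i \<noteq> \<one>")
      case True
      then have "w [^] p \<noteq> \<one>" using pow_p_ne_one_if_meets_kernel[OF w wM] by blast
      then obtain i :: nat where "z = w [^] i"
        using commuting_kernel_element_is_power[OF w _ z(1,3)] by blast
      then show ?thesis using G.group_commutes_pow[of w r i] rw wG rG by simp
    next
      case False
      have wr: "cyc_pair G w r" using G.cyc_pair_p_element_p_regular[OF w r] rw by simp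
      have "inv z \<otimes> w \<otimes> z = w" using z(3) wG zG by (simp add: G.m_assoc G.inv_cancel)
      then have "cyc_pair G w (inv z \<otimes> r \<otimes> z)" using G.cyc_pair_conj[OF wr zG] by simp
      then have t: "cyc_pair G w (inv r \<otimes> (inv z \<otimes> r \<otimes> z))"
        using G.cyc_pair_tidy[OF fin tidy] wr by blast
      define t where "t = inv r \<otimes> (inv z \<otimes> r \<otimes> z)"
      have tM: "t \<in> M" unfolding t_def using conj z(1) by simp
      have "t = \<one>"
      proof -
        consider (1) i :: nat where "w = t [^] i" | (2) i :: nat where "t = w [^] i"
          using G.cyc_pair_p_element_power[OF fin prime w p_element_M[OF tM]] t unfolding t_def[symmetric] by blast
        then show ?thesis
        proof cases
          case 1
          then show ?thesis using M_pow[OF tM] wM by blast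
        next
          case 2
          then show ?thesis using False tM by blast
        qed
      qed
      have "r \<otimes> t = inv z \<otimes> r \<otimes> z" unfolding t_def using rG zG by (simp add: G.inv_cancel)
      then have "z \<otimes> r = z \<otimes> (inv z \<otimes> r \<otimes> z)" using \<open>t = \<one>\<close> rG by simp
      then show ?thesis using rG zG by (simp add: G.m_assoc G.inv_cancel)
    qed
    have "cyc_pair G z r" using G.cyc_pair_p_element_p_regular[OF p_element_M[OF z(1)] r] rz by simp
    note zr = this
    have "inv m' \<otimes> z \<otimes> m' = z"
      using ker_comm[OF z(1) m'] zG m'G by (simp add: G.m_assoc G.inv_cancel)
    then have "cyc_pair G z (inv m' \<otimes> r \<otimes> m')" using G.cyc_pair_conj[OF zr m'G] by simp
    then have zt: "cyc_pair G z (inv r \<otimes> (inv m' \<otimes> r \<otimes> m'))"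
      using G.cyc_pair_tidy[OF fin tidy] zr by blast
    define t where "t = inv r \<otimes> (inv m' \<otimes> r \<otimes> m')"
    have tM: "t \<in> M" unfolding t_def using conj m' by simp
    obtain i :: nat where "t = z [^] i"
      using mem_powers_if_order_p[OF z(1,2) tM] zt unfolding t_def by blast
    then have "r \<otimes> t = t \<otimes> r" using G.group_commutes_pow[of z r i] rz zG rG by simp
    moreover have rt: "r \<otimes> t = inv m' \<otimes> r \<otimes> m'" unfolding t_def using rG m'G by (simp add: G.inv_cancel)
    ultimately have "t = \<one>" using comm tM m'G by blast
    then have "m' \<otimes> r = m' \<otimes> (inv m' \<otimes> r \<otimes> m')" using rt rG by simp
    then show ?thesis using rG m'G by (simp add: G.m_assoc G.inv_cancel)
  qed
  have "(r \<otimes> x) \<otimes> m = (x \<otimes> m) \<otimes> r"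
    using m(2) rG xG mG by (simp add: G.m_assoc)
  also have "\<dots> = (x \<otimes> r) \<otimes> m"
    using rm'[OF m(1)] rG xG mG by (simp add: G.m_assoc)
  finally show ?thesis using rG xG mG G.r_cancel by simp
qed

lemma has_preimage: "y \<in> carrier H \<Longrightarrow> \<exists>x \<in> carrier G. h x = y"
  using surj by (metis imageE)

lemma finite_image: "finite (carrier H)"
  using fin surj by (metis finite_imageI)

text \<open>A generator \<open>c'\<close> of a cyclic group containing \<open>y\<close> lifts to some \<open>c\<close>.  The \<open>p\<close>-regular part of the
corresponding power of \<open>c\<close> is a preimage of \<open>y\<close>, hence conjugate under \<open>M\<close> to the fixed
\<open>p\<close>-regular preimage \<open>x\<close>; conjugating \<open>c\<close> by the same element does not change its image.\<close>

lemma Cyc_p_regular_image: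
  assumes y: "p_regular H p y"
  shows "\<exists>x \<in> carrier G. Cyc H y = h ` Cyc G x"
proof -
  have yH: "y \<in> carrier H" using y H.p_regularD by blast
  obtain x0 where x0: "x0 \<in> carrier G" "h x0 = y" using has_preimage[OF yH] by blast
  obtain e f :: nat where ef: "p_element G p (x0 [^] e)" "p_regular G p (x0 [^] f)" "x0 [^] e \<otimes> x0 [^] f = x0"
    using G.p_part_exponents[OF fin prime x0(1)] by metis
  define x where "x = x0 [^] f"
  have xG: "x \<in> carrier G" using x0 x_def by simp
  have "h (x0 [^] e) = \<one>\<^bsub>H\<^esub>"
  proof (rule H.p_element_p_regular_one)
    show "p_element H p (h (x0 [^] e))" using p_element_hom ef by blast
    show "p_regular H p (h (x0 [^] e))" using H.p_regular_pow[OF y] x0 by (simp add: hom_nat_pow)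
  qed
  then have hx: "h x = y"
    using arg_cong[OF ef(3), of h] x0 unfolding x_def by simp
  have "Cyc H y = h ` Cyc G x"
  proof
    show "h ` Cyc G x \<subseteq> Cyc H y"
      using G.Cyc_iff_cyc_pair[OF fin xG] H.Cyc_iff_cyc_pair[OF finite_image yH] cyc_pair_hom hx by fastforce
    show "Cyc H y \<subseteq> h ` Cyc G x"
    proof
      fix g' assume "g' \<in> Cyc H y"
      then have "cyc_pair H y g'" using H.Cyc_iff_cyc_pair[OF finite_image yH] by blast
      then obtain c' and i j :: nat where c': "c' \<in> carrier H" "y = c' [^]\<^bsub>H\<^esub> i" "g' = c' [^]\<^bsub>H\<^esub> j"
        unfolding cyc_pair_def by blast
      obtain c where c: "c \<in> carrier G" "h c = c'" using has_preimage[OF c'(1)] by blast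
      obtain e f :: nat where ef: "p_element G p (c [^] e)" "p_regular G p (c [^] f)" "c [^] e \<otimes> c [^] f = c"
        using G.p_part_exponents[OF fin prime c(1)] by metis
      define x' where "x' = c [^] (f * i)"
      have x'G: "x' \<in> carrier G" using c x'_def by simp
      have x': "p_regular G p x'" unfolding x'_def using G.p_regular_pow[OF ef(2), of i] c by (simp add: G.nat_pow_pow)
      have pe: "p_element G p (c [^] (e * i))" using G.p_element_pow[OF ef(1), of i] c by (simp add: G.nat_pow_pow)
      have "h (c [^] (e * i)) = y [^]\<^bsub>H\<^esub> e"
        using c c' by (simp add: hom_nat_pow H.nat_pow_pow mult.commute)
      then have "h (c [^] (e * i)) = \<one>\<^bsub>H\<^esub>"
        using H.p_element_p_regular_one p_element_hom[OF pe] H.p_regular_pow[OF y] by simp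
      moreover have "c [^] (e * i) \<otimes> x' = c [^] i"
      proof -
        have "(c [^] e \<otimes> c [^] f) [^] i = (c [^] e) [^] i \<otimes> (c [^] f) [^] i"
          by (rule G.pow_mult_distrib[OF G.nat_pow_comm]) (use c(1) in simp_all)
        then show ?thesis unfolding x'_def using ef(3) c by (simp add: G.nat_pow_pow)
      qed
      then have "h (c [^] (e * i)) \<otimes>\<^bsub>H\<^esub> h x' = y"
        using c c' x'G by (metis G.nat_pow_closed hom_mult hom_nat_pow)
      ultimately have hx': "h x' = y" using x'G by simp
      obtain n1 n2 where n: "coprime n1 p" "x [^] n1 = \<one>" "coprime n2 p" "x' [^] n2 = \<one>"
        using ef x' \<open>p_regular G p (x0 [^] _)\<close> unfolding p_regular_def x_def by blast
      have "x [^] (n1 * n2) = \<one>" "x' [^] (n1 * n2) = \<one>"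
        using n xG x'G by (metis G.nat_pow_pow G.nat_pow_one mult.commute)+
      moreover have "coprime (n1 * n2) p" using n by simp
      ultimately obtain m where m: "m \<in> M" "x \<otimes> (\<one> \<otimes> m) = (\<one> \<otimes> m) \<otimes> x'"
        using intertwiner_in_coset[of "n1 * n2" x x' \<one>] xG x'G hx hx' by auto
      have mG: "m \<in> carrier G" using m M_carrier by blast
      have "m \<otimes> x' \<otimes> inv m = x"
        using m(2) mG xG x'G by (metis G.inv_solve_right G.l_one G.m_closed)
      moreover have "cyc_pair G x' (c [^] j)"
        unfolding cyc_pair_def x'_def using c by blast
      ultimately have "cyc_pair G x (m \<otimes> c [^] j \<otimes> inv m)"
        using G.cyc_pair_conj[of x' "c [^] j" "inv m"] mG by simp
      moreover have "h (m \<otimes> c [^] j \<otimes> inv m) = g'"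
        using m(1) mG c c' by (simp add: M_iff hom_nat_pow)
      ultimately show "g' \<in> h ` Cyc G x"
        using G.Cyc_iff_cyc_pair[OF fin xG] by blast
    qed
  qed
  then show ?thesis using xG by blast
qed

text \<open>The powers of the preimage \<open>x\<close> are required to meet \<open>M\<close> nontrivially if this happens for any
preimage of \<open>y\<close>.  This makes \<open>x\<close> comparable with preimages that are proper powers of other elements.

Let \<open>g\<close> be a preimage of an element of \<open>Cyc H y\<close> with \<open>p\<close>-part \<open>u\<close> and \<open>p\<close>-regular part \<open>r\<close>.  Then
\<open>r\<close> commutes with \<open>x\<close>.  If \<open>h u\<close> is a power of \<open>y\<close>, replace \<open>u\<close> by the same power of \<open>x\<close>.  Otherwise \<open>y\<close>
is a power of \<open>h u\<close>, and the claim is that \<open>x\<close> is a power of \<open>u\<close>.\<close>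

lemma Cyc_p_element_image:
  assumes y: "p_element H p y"
  shows "\<exists>x \<in> carrier G. Cyc H y = h ` Cyc G x"
proof (cases "y = \<one>\<^bsub>H\<^esub>")
  case True
  have "Cyc G \<one> = carrier G"
    using G.Cyc_iff_cyc_pair[OF fin G.one_closed] G.cyc_pair_self_pow[of _ 0] cyc_pair_sym[of G]
      G.cyc_pair_closed by fastforce
  moreover have "Cyc H \<one>\<^bsub>H\<^esub> = carrier H"
    using H.Cyc_iff_cyc_pair[OF finite_image H.one_closed] H.cyc_pair_self_pow[of _ 0] cyc_pair_sym[of H]
      H.cyc_pair_closed by fastforce
  ultimately show ?thesis using True surj G.one_closed by metis
next
  case y1: False
  have yH: "y \<in> carrier H" using y H.p_elementD by blast
  define meets_kernel where "meets_kernel x \<longleftrightarrow> (\<exists>i :: nat. x [^] i \<in> M \<and> x [^] i \<noteq> \<one>)" for x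
  have "\<exists>x \<in> carrier G. h x = y \<and> ((\<exists>w \<in> carrier G. h w = y \<and> meets_kernel w) \<longrightarrow> meets_kernel x)"
  proof -
    obtain x0 where "x0 \<in> carrier G" "h x0 = y" using has_preimage[OF yH] by blast
    then show ?thesis by blast
  qed
  then obtain x where xG: "x \<in> carrier G" and hx: "h x = y"
    and best: "\<And>w. w \<in> carrier G \<Longrightarrow> h w = y \<Longrightarrow> meets_kernel w \<Longrightarrow> meets_kernel x"
    by blast
  have x: "p_element G p x" using lift_p_element xG hx y by simp
  have xM: "x \<notin> M" using hx y1 by (simp add: M_iff)
  have "Cyc H y = h ` Cyc G x"
  proof
    show "h ` Cyc G x \<subseteq> Cyc H y"
      using G.Cyc_iff_cyc_pair[OF fin xG] H.Cyc_iff_cyc_pair[OF finite_image yH] cyc_pair_hom hx by fastforce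
    show "Cyc H y \<subseteq> h ` Cyc G x"
    proof
      fix g' assume "g' \<in> Cyc H y"
      then have yg: "cyc_pair H y g'" using H.Cyc_iff_cyc_pair[OF finite_image yH] by blast
      obtain g where g: "g \<in> carrier G" "h g = g'" using has_preimage H.cyc_pair_closed[OF yg] by blast
      obtain e f :: nat where ef: "p_element G p (g [^] e)" "p_regular G p (g [^] f)" "g [^] e \<otimes> g [^] f = g"
        using G.p_part_exponents[OF fin prime g(1)] by metis
      define u where "u = g [^] e"
      define r where "r = g [^] f"
      have uG: "u \<in> carrier G" and rG: "r \<in> carrier G" using g u_def r_def by auto
      have hg: "h u \<otimes>\<^bsub>H\<^esub> h r = g'"
        using ef(3) g unfolding u_def r_def by (metis G.nat_pow_closed hom_mult)
      have yu: "cyc_pair H y (h u)" and yr: "cyc_pair H y (h r)"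
        using H.cyc_pair_pow[OF yg, of 1] yH g unfolding u_def r_def by (simp_all add: hom_nat_pow)
      have rx: "r \<otimes> x = x \<otimes> r"
        using p_regular_commutes_if_commutes_mod_kernel[OF x xM ef(2)] H.cyc_pair_commute[OF yr] hx xG rG
        unfolding r_def by simp
      have "\<exists>g0. cyc_pair G x g0 \<and> h g0 = g'"
      proof (cases "\<exists>k :: nat. h u = y [^]\<^bsub>H\<^esub> k")
        case True
        then obtain k :: nat where k: "h u = y [^]\<^bsub>H\<^esub> k" by blast
        have "cyc_pair G (x \<otimes> \<one>) (x [^] k \<otimes> r)"
        proof (rule G.cyc_pair_combine[OF fin x G.p_element_pow[OF x] G.cyc_pair_self_pow[OF xG] G.p_regular_one ef(2)[folded r_def]])
          show "cyc_pair G \<one> r" using cyc_pair_sym[OF G.cyc_pair_self_pow[OF rG, of 0]] by simp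
          show "x [^] k \<otimes> r = r \<otimes> x [^] k" using G.group_commutes_pow rx xG rG by metis
        qed (use rx xG in simp_all)
        moreover have "h (x [^] k \<otimes> r) = g'" using k hg hx xG rG by (simp add: hom_nat_pow)
        ultimately show ?thesis using xG by auto
      next
        case no: False
        then obtain k :: nat where k: "y = h u [^]\<^bsub>H\<^esub> k"
          using H.cyc_pair_p_element_power[OF finite_image prime y p_element_hom[OF ef(1)]] yu unfolding u_def by blast
        define w where "w = u [^] k"
        have wG: "w \<in> carrier G" using uG w_def by simp
        have hw: "h w = y" using k uG w_def by (simp add: hom_nat_pow)
        have wM: "w \<notin> M" using hw y1 by (simp add: M_iff)
        define m where "m = inv w \<otimes> x"
        have mM: "m \<in> M" unfolding m_def using hw hx xG wG yH by (simp add: M_iff)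
        have mG: "m \<in> carrier G" using mM M_carrier by blast
        have xwm: "x = w \<otimes> m" unfolding m_def using xG wG by (simp add: G.inv_cancel)
        have "\<exists>l :: nat. x = u [^] l"
        proof (cases "M = {\<one>}")
          case True
          then show ?thesis using xwm mM wG w_def by auto
        next
          case False
          \<comment> \<open>Otherwise \<open>h u\<close> would have order \<open>p\<close> and be a power of its nontrivial power \<open>y\<close>.\<close>
          have up: "u [^] p \<noteq> \<one>"
          proof
            assume "u [^] p = \<one>"
            then have "h u [^]\<^bsub>H\<^esub> p = \<one>\<^bsub>H\<^esub>" using uG by (metis hom_nat_pow hom_one)
            then obtain j :: nat where "h u = (h u [^]\<^bsub>H\<^esub> k) [^]\<^bsub>H\<^esub> j"
              using H.prime_order_power[OF prime, of "h u" k] uG k y1 by auto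
            then show False using no k by metis
          qed
          obtain z where z: "z \<in> M" "z \<noteq> \<one>" "u \<otimes> z = z \<otimes> u"
            using nontrivial_kernel_centralizer[OF ef(1)[folded u_def] False] by blast
          have zG: "z \<in> carrier G" using z M_carrier by blast
          obtain a :: nat where a: "z = u [^] a"
            using commuting_kernel_element_is_power[OF ef(1)[folded u_def] up z(1,3)] by blast
          \<comment> \<open>Both \<open>z\<close> and \<open>w\<close> are powers of \<open>u\<close>, and \<open>w\<close> is not a power of \<open>z\<close>.  So the powers of \<open>w\<close> meet
            \<open>M\<close> nontrivially, and by the choice of \<open>x\<close> the same holds for \<open>x\<close>.\<close>
          have zw: "cyc_pair G z w" unfolding a w_def cyc_pair_def using uG by blast
          have w: "p_element G p w" unfolding w_def using G.p_element_pow ef(1) u_def by simp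
          consider (1) b :: nat where "z = w [^] b" | (2) b :: nat where "w = z [^] b"
            using G.cyc_pair_p_element_power[OF fin prime p_element_M[OF z(1)] w zw] by blast
          then obtain b :: nat where b: "z = w [^] b"
            using M_pow[OF z(1)] wM by cases auto
          then have "meets_kernel w" unfolding meets_kernel_def using z by metis
          then have "meets_kernel x" using best wG hw by blast
          then have xp: "x [^] p \<noteq> \<one>" unfolding meets_kernel_def using pow_p_ne_one_if_meets_kernel[OF x xM] by blast
          have "x \<otimes> z = z \<otimes> x"
          proof -
            have "w \<otimes> z = z \<otimes> w" using G.cyc_pair_commute[OF zw] by simp
            then show ?thesis
              unfolding xwm using ker_comm[OF mM z(1)] wG mG zG by (metis G.m_assoc)
          qed
          then obtain b' :: nat where "z = x [^] b'"
            using commuting_kernel_element_is_power[OF x xp z(1)] by blast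
          then have "cyc_pair G z x" using cyc_pair_sym[OF G.cyc_pair_self_pow[OF xG]] by simp
          \<comment> \<open>Now \<open>w\<close> and \<open>x\<close> lie in the cyclicizer of \<open>z\<close>, hence so does their quotient \<open>m\<close>, which is
            therefore a power of \<open>z\<close>, hence of \<open>w\<close>.\<close>
          then have "cyc_pair G z m"
            unfolding m_def using G.cyc_pair_tidy[OF fin tidy] zw by blast
          then obtain q :: nat where "m = z [^] q"
            using mem_powers_if_order_p[OF z(1,2) mM] by blast
          then have "x = w [^] (1 + b * q)"
            using xwm b wG G.nat_pow_mult[OF wG, of 1 "b * q"] by (simp add: G.nat_pow_pow)
          then show ?thesis unfolding w_def using uG by (metis G.nat_pow_pow)
        qed
        then obtain l :: nat where "x = u [^] l" by blast
        then have "x = g [^] (e * l)" unfolding u_def using g by (simp add: G.nat_pow_pow)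
        then have "cyc_pair G x g" using cyc_pair_sym[OF G.cyc_pair_self_pow[OF g(1)]] by simp
        then show ?thesis using g by blast
      qed
      then show "g' \<in> h ` Cyc G x" using G.Cyc_iff_cyc_pair[OF fin xG] by blast
    qed
  qed
  then show ?thesis using xG by blast
qed

theorem tidy_image: "tidy H"
  unfolding tidy_def
proof
  fix y assume y: "y \<in> carrier H"
  obtain e f :: nat where ef: "p_element H p (y [^]\<^bsub>H\<^esub> e)" "p_regular H p (y [^]\<^bsub>H\<^esub> f)"
      "y [^]\<^bsub>H\<^esub> e \<otimes>\<^bsub>H\<^esub> y [^]\<^bsub>H\<^esub> f = y"
    using H.p_part_exponents[OF finite_image prime y] by metis
  have img: "subgroup (h ` Cyc G x) H" if "x \<in> carrier G" for x
    using subgroup_img_is_subgroup tidy that unfolding tidy_def by blast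
  have "subgroup (Cyc H (y [^]\<^bsub>H\<^esub> e)) H" "subgroup (Cyc H (y [^]\<^bsub>H\<^esub> f)) H"
    using Cyc_p_element_image[OF ef(1)] Cyc_p_regular_image[OF ef(2)] img by auto
  moreover have "Cyc H y = Cyc H (y [^]\<^bsub>H\<^esub> e) \<inter> Cyc H (y [^]\<^bsub>H\<^esub> f)"
    using H.cyc_pair_parts_iff[OF finite_image prime ef(1,2) H.nat_pow_comm[OF y]] y ef(3)
      H.Cyc_iff_cyc_pair[OF finite_image] by auto
  ultimately show "subgroup (Cyc H y) H"
    using H.subgroups_Inter_pair by metis
qed

end

section \<open>Chains of normal subgroups in a solvable group\<close>

lemma normal_hom_Mod:
  assumes "A \<lhd> G"
  shows "group_hom G (G Mod A) (\<lambda>x. A #>\<^bsub>G\<^esub> x)"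
  using assms normal.r_coset_hom_Mod[OF assms] normal.factorgroup_is_group[OF assms]
  by (simp add: group_hom_def group_hom_axioms_def normal_def)

context group
begin

lemma eq_if_mult_inv_one:
  assumes "a \<otimes> inv b = \<one>" "a \<in> carrier G" "b \<in> carrier G"
  shows "a = b"
  using inv_equality[OF assms(1)] assms(2,3) by simp

lemma coset_eq_iff:
  assumes "subgroup A G" "x \<in> carrier G"
  shows "A #> x = A \<longleftrightarrow> x \<in> A"
  using coset_join1 coset_join2 assms by blast

text \<open>This shows that \<open>U \<mapsto> B <#> U\<close> is the canonical map from \<open>G Mod A\<close> to \<open>G Mod B\<close>.\<close>

lemma set_mult_coset:
  assumes "subgroup A G" "subgroup B G" "A \<subseteq> B" "x \<in> carrier G"
  shows "B <#> (A #> x) = B #> x"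
proof
  note cl = subgroup.mem_carrier[OF assms(1)] subgroup.mem_carrier[OF assms(2)]
  show "B <#> (A #> x) \<subseteq> B #> x"
  proof
    fix y assume "y \<in> B <#> (A #> x)"
    then obtain b a where "b \<in> B" "a \<in> A" "y = b \<otimes> (a \<otimes> x)"
      unfolding set_mult_def r_coset_def by blast
    then have "y = (b \<otimes> a) \<otimes> x" "b \<otimes> a \<in> B"
      using assms cl by (auto simp: m_assoc subgroup.m_closed)
    then show "y \<in> B #> x" unfolding r_coset_def by blast
  qed
  show "B #> x \<subseteq> B <#> (A #> x)"
    using rcos_self[OF assms(4,1)] unfolding set_mult_def r_coset_def by blast
qed

lemma tidy_Mod_trivial:
  assumes "finite (carrier G)" "tidy G" shows "tidy (G Mod {\<one>})"
proof -
  interpret q: group_hom G "G Mod {\<one>}" "\<lambda>x. {\<one>} #> x"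
    by (rule normal_hom_Mod[OF one_is_normal])
  have k: "kernel G (G Mod {\<one>}) (\<lambda>x. {\<one>} #> x) = {\<one>}"
    using coset_eq_iff[OF triv_subgroup] unfolding kernel_def by (auto simp: FactGroup_def)
  \<comment> \<open>The kernel is trivial, so any prime can serve as its exponent.\<close>
  interpret tidy_extension G "G Mod {\<one>}" "\<lambda>x. {\<one>} #> x" 2
  proof unfold_locales
    show "(\<lambda>x. {\<one>} #> x) ` carrier G = carrier (G Mod {\<one>})"
      by (auto simp: FactGroup_def RCOSETS_def)
  qed (use assms k in simp_all)
  show ?thesis by (rule tidy_image)
qed

lemma exp_of_derived_is_normal: "(derived G ^^ n) (carrier G) \<lhd> G"
  by (induction n) (simp_all add: derived_is_normal normal_self)

text \<open>Intersect the terms of the derived series of \<open>G\<close> with \<open>N\<close>, and let \<open>W\<close> be the last intersection not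
contained in \<open>A\<close>; it is abelian modulo \<open>A\<close>.  For a prime \<open>p\<close> dividing the order of some element of \<open>W\<close> modulo \<open>A\<close>, the
elements of \<open>W\<close> modulo \<open>A\<close> annihilated by \<open>p\<close> form the required \<open>B\<close>.\<close>

lemma elementary_abelian_section:
  assumes fin: "finite (carrier G)" and solv: "solvable G"
    and A: "A \<lhd> G" and N: "N \<lhd> G" and AN: "A \<subset> N"
  obtains p B where "Factorial_Ring.prime (p :: nat)" "B \<lhd> G" "A \<subset> B" "B \<subseteq> N"
    "\<And>b. b \<in> B \<Longrightarrow> b [^] p \<in> A"
    "\<And>b c. b \<in> B \<Longrightarrow> c \<in> B \<Longrightarrow> A #> (b \<otimes> c) = A #> (c \<otimes> b)"
proof -
  define D where "D n = (derived G ^^ n) (carrier G)" for n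
  have Dn: "D n \<lhd> G" for n unfolding D_def by (rule exp_of_derived_is_normal)
  have D0: "D 0 = carrier G" by (simp add: D_def)
  note subA = normal_imp_subgroup[OF A] and subN = normal_imp_subgroup[OF N]
  obtain n where "D n = {\<one>}"
    using solvable_iff_trivial_derived_seq solv unfolding D_def by blast
  then have ex: "D n \<inter> N \<subseteq> A" using subgroup.one_closed[OF subA] by auto
  define i where "i = (LEAST i. D i \<inter> N \<subseteq> A)"
  have i: "D i \<inter> N \<subseteq> A" unfolding i_def by (rule LeastI[of "\<lambda>i. D i \<inter> N \<subseteq> A", OF ex])
  have "i \<noteq> 0" using i AN D0 subgroup.subset[OF subN] by auto
  then obtain k where k: "i = Suc k" by (cases i) auto
  define W where "W = D k \<inter> N"
  have WA: "\<not> W \<subseteq> A"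
    unfolding W_def using not_less_Least[of k "\<lambda>i. D i \<inter> N \<subseteq> A"] k unfolding i_def by simp
  have W: "W \<lhd> G" unfolding W_def using normal_subgroup_intersect Dn N by blast
  note subW = normal_imp_subgroup[OF W]
  have WG: "w \<in> carrier G" if "w \<in> W" for w using subgroup.mem_carrier[OF subW that] .
  define Q where "Q = G Mod A"
  define \<phi> where "\<phi> x = A #> x" for x
  interpret q: group_hom G Q \<phi>
    unfolding \<phi>_def Q_def by (rule normal_hom_Mod[OF A])
  have one: "\<phi> x = \<one>\<^bsub>Q\<^esub> \<longleftrightarrow> x \<in> A" if "x \<in> carrier G" for x
    using coset_eq_iff[OF subA that] by (simp add: \<phi>_def Q_def FactGroup_def)
  have Wcomm: "\<phi> v \<otimes>\<^bsub>Q\<^esub> \<phi> w = \<phi> w \<otimes>\<^bsub>Q\<^esub> \<phi> v" if vw: "v \<in> W" "w \<in> W" for v w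
  proof -
    have c: "v \<otimes> w \<otimes> inv v \<otimes> inv w \<in> derived G (D k)"
      unfolding derived_def using vw W_def by (intro generate.incl) blast
    moreover have "v \<otimes> w \<otimes> inv v \<otimes> inv w \<in> N"
      using vw unfolding W_def by (intro subgroup.m_closed[OF subN] subgroup.m_inv_closed[OF subN]) auto
    ultimately have "v \<otimes> w \<otimes> inv v \<otimes> inv w \<in> A" using i unfolding k D_def by auto
    then have "\<phi> (v \<otimes> w \<otimes> inv v \<otimes> inv w) = \<one>\<^bsub>Q\<^esub>"
      by (intro iffD2[OF one]) (use WG vw in simp_all)
    then have "\<phi> (v \<otimes> w) \<otimes>\<^bsub>Q\<^esub> inv\<^bsub>Q\<^esub> \<phi> (w \<otimes> v) = \<one>\<^bsub>Q\<^esub>"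
      using WG vw by (simp add: q.H.m_assoc q.H.inv_mult_group)
    then have "\<phi> (v \<otimes> w) = \<phi> (w \<otimes> v)"
      by (rule q.H.eq_if_mult_inv_one) (use WG vw in simp_all)
    then show ?thesis using WG vw by simp
  qed
  obtain d where d: "d \<in> W" "d \<notin> A" using WA by blast
  define r where "r = q.H.ord (\<phi> d)"
  have dG: "d \<in> carrier G" and dH: "\<phi> d \<in> carrier Q" using WG d q.hom_closed by auto
  have "r \<noteq> 1" unfolding r_def using q.H.ord_eq_1[OF dH] one[OF dG] d by simp
  then obtain p where p: "Factorial_Ring.prime p" "p dvd r" using prime_factor_nat by blast
  have dr: "d [^] r \<in> A"
    using q.H.pow_ord_eq_1[OF dH] one[of "d [^] r"] dG unfolding r_def by (simp add: q.hom_nat_pow)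
  define e where "e = d [^] (r div p)"
  have eG: "e \<in> carrier G" using dG e_def by simp
  have "d [^] n \<in> W" for n :: nat
    using d(1) subW by (induction n) (simp_all add: subgroup.one_closed subgroup.m_closed)
  then have eW: "e \<in> W" unfolding e_def .
  have ep: "e [^] p \<in> A" unfolding e_def using dr p(2) dG by (simp add: nat_pow_pow)
  have eA: "e \<notin> A"
  proof
    assume "e \<in> A"
    then have "\<phi> d [^]\<^bsub>Q\<^esub> (r div p) = \<one>\<^bsub>Q\<^esub>"
      using one[OF eG] dG unfolding e_def by (simp add: q.hom_nat_pow)
    then have "r dvd r div p" unfolding r_def using q.H.pow_eq_id[OF dH] by blast
    moreover have "finite (carrier Q)"
      using fin by (simp add: Q_def FactGroup_def RCOSETS_def)
    then have "r > 0" unfolding r_def using q.H.ord_ge_1 dH by fastforce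
    moreover have "r div p < r" "r div p > 0"
      using p \<open>r > 0\<close> prime_gt_1_nat[OF p(1)] by (auto simp: dvd_imp_le div_greater_zero_iff)
    ultimately show False
      using nat_dvd_not_less by blast
  qed
  define B where "B = {b \<in> carrier G. (\<exists>w \<in> W. \<phi> b = \<phi> w) \<and> \<phi> b [^]\<^bsub>Q\<^esub> p = \<one>\<^bsub>Q\<^esub>}"
  have BI: "b \<in> B" if "b \<in> carrier G" "w \<in> W" "\<phi> b = \<phi> w" "\<phi> b [^]\<^bsub>Q\<^esub> p = \<one>\<^bsub>Q\<^esub>" for b w
    unfolding B_def using that by blast
  have Bcomm: "\<phi> b \<otimes>\<^bsub>Q\<^esub> \<phi> c = \<phi> c \<otimes>\<^bsub>Q\<^esub> \<phi> b" if "b \<in> B" "c \<in> B" for b c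
    using that Wcomm unfolding B_def by auto
  have subB: "subgroup B G"
  proof (rule subgroupI)
    show "B \<subseteq> carrier G" unfolding B_def by blast
    have "\<one> \<in> B" by (rule BI[OF _ subgroup.one_closed[OF subW]]) simp_all
    then show "B \<noteq> {}" by blast
  next
    fix b assume b: "b \<in> B"
    then obtain w where w: "w \<in> W" "\<phi> b = \<phi> w" and bG: "b \<in> carrier G" unfolding B_def by blast
    have 1: "\<phi> (inv b) = \<phi> (inv w)" using w bG WG by simp
    have 2: "\<phi> (inv b) [^]\<^bsub>Q\<^esub> p = \<one>\<^bsub>Q\<^esub>"
      using b bG unfolding B_def by (simp add: q.H.nat_pow_inv)
    show "inv b \<in> B"
      by (rule BI[OF inv_closed[OF bG] subgroup.m_inv_closed[OF subW w(1)] 1 2])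
  next
    fix b c assume bc: "b \<in> B" "c \<in> B"
    then obtain v w where vw: "v \<in> W" "\<phi> b = \<phi> v" "w \<in> W" "\<phi> c = \<phi> w"
      and G: "b \<in> carrier G" "c \<in> carrier G" unfolding B_def by blast
    have 1: "\<phi> (b \<otimes> c) = \<phi> (v \<otimes> w)" using vw G WG by simp
    have 2: "\<phi> (b \<otimes> c) [^]\<^bsub>Q\<^esub> p = \<one>\<^bsub>Q\<^esub>"
      using bc G Bcomm[OF bc] unfolding B_def by (simp add: q.H.pow_mult_distrib)
    show "b \<otimes> c \<in> B"
      by (rule BI[OF m_closed[OF G] subgroup.m_closed[OF subW vw(1,3)] 1 2])
  qed
  have normB: "B \<lhd> G"
    unfolding normal_inv_iff
  proof (intro conjI ballI subB)
    fix x b assume x: "x \<in> carrier G" and b: "b \<in> B"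
    then obtain w where w: "w \<in> W" "\<phi> b = \<phi> w" and bG: "b \<in> carrier G" unfolding B_def by blast
    have 1: "\<phi> (x \<otimes> b \<otimes> inv x) = \<phi> (x \<otimes> w \<otimes> inv x)" using w bG WG x by simp
    have 2: "x \<otimes> w \<otimes> inv x \<in> W" using W normal_inv_iff x w(1) by blast
    have 3: "\<phi> (x \<otimes> b \<otimes> inv x) [^]\<^bsub>Q\<^esub> p = \<one>\<^bsub>Q\<^esub>"
      using q.H.conj_pow[of "\<phi> b" "inv\<^bsub>Q\<^esub> \<phi> x" p] b x bG unfolding B_def by simp
    show "x \<otimes> b \<otimes> inv x \<in> B"
      by (rule BI[OF _ 2 1 3]) (use x bG in simp)
  qed
  have AB: "A \<subseteq> B"
  proof
    fix a assume a: "a \<in> A"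
    then have "a \<in> carrier G" using subgroup.mem_carrier[OF subA] by blast
    moreover have "\<phi> a = \<one>\<^bsub>Q\<^esub>" using one calculation a by blast
    ultimately show "a \<in> B"
      by (intro BI[OF _ subgroup.one_closed[OF subW]]) simp_all
  qed
  have "e \<in> B"
    by (rule BI[OF eG eW refl]) (use eG ep one[of "e [^] p"] in \<open>simp add: q.hom_nat_pow\<close>)
  then have "A \<subset> B" using AB eA by blast
  moreover have "B \<subseteq> N"
  proof
    fix b assume "b \<in> B"
    then obtain w where w: "w \<in> W" "\<phi> b = \<phi> w" and bG: "b \<in> carrier G" unfolding B_def by blast
    have "\<phi> (b \<otimes> inv w) = \<one>\<^bsub>Q\<^esub>" using w bG WG by simp
    then have "b \<otimes> inv w \<in> N" using one[of "b \<otimes> inv w"] bG WG[OF w(1)] AN by auto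
    then have "b \<otimes> inv w \<otimes> w \<in> N" by (rule subgroup.m_closed[OF subN]) (use w(1) W_def in blast)
    then show "b \<in> N" using bG WG[OF w(1)] by (simp add: m_assoc)
  qed
  moreover have "b [^] p \<in> A" if "b \<in> B" for b
    using that one[of "b [^] p"] unfolding B_def by (auto simp: q.hom_nat_pow)
  moreover have "A #> (b \<otimes> c) = A #> (c \<otimes> b)" if "b \<in> B" "c \<in> B" for b c
    using Bcomm[OF that] subgroup.mem_carrier[OF subB] that unfolding \<phi>_def[symmetric] by simp
  ultimately show thesis using that p(1) normB by blast
qed

lemma tidy_Mod_step:
  assumes fin: "finite (carrier G)" and p: "Factorial_Ring.prime (p :: nat)"
    and A: "A \<lhd> G" and B: "B \<lhd> G" "A \<subseteq> B" and tidy: "tidy (G Mod A)"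
    and exp: "\<And>b. b \<in> B \<Longrightarrow> b [^] p \<in> A"
    and comm: "\<And>b c. b \<in> B \<Longrightarrow> c \<in> B \<Longrightarrow> A #> (b \<otimes> c) = A #> (c \<otimes> b)"
  shows "tidy (G Mod B)"
proof -
  note subA = normal_imp_subgroup[OF A] and subB = normal_imp_subgroup[OF B(1)]
  interpret a: group_hom G "G Mod A" "\<lambda>x. A #> x" by (rule normal_hom_Mod[OF A])
  interpret b: group_hom G "G Mod B" "\<lambda>x. B #> x" by (rule normal_hom_Mod[OF B(1)])
  define \<theta> where "\<theta> U = B <#> U" for U
  have \<theta>: "\<theta> (A #> x) = B #> x" if "x \<in> carrier G" for x
    unfolding \<theta>_def using set_mult_coset subA subB B(2) that by blast
  have cA: "\<exists>x \<in> carrier G. U = A #> x" if "U \<in> carrier (G Mod A)" for U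
    using that by (auto simp: FactGroup_def RCOSETS_def)
  have cB: "\<exists>x \<in> carrier G. U = B #> x" if "U \<in> carrier (G Mod B)" for U
    using that by (auto simp: FactGroup_def RCOSETS_def)
  interpret t: group_hom "G Mod A" "G Mod B" \<theta>
  proof (unfold_locales, rule homI)
    fix U assume "U \<in> carrier (G Mod A)"
    then obtain x where "x \<in> carrier G" "U = A #> x" using cA by blast
    then show "\<theta> U \<in> carrier (G Mod B)" using \<theta> b.hom_closed by metis
  next
    fix U V assume "U \<in> carrier (G Mod A)" "V \<in> carrier (G Mod A)"
    then obtain x y where xy: "x \<in> carrier G" "y \<in> carrier G" "U = A #> x" "V = A #> y" using cA by blast
    then show "\<theta> (U \<otimes>\<^bsub>G Mod A\<^esub> V) = \<theta> U \<otimes>\<^bsub>G Mod B\<^esub> \<theta> V"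
      by (simp only: a.hom_mult[OF xy(1,2), symmetric] b.hom_mult[OF xy(1,2), symmetric] \<theta> m_closed xy)
  qed
  have ker: "\<exists>b \<in> B. U = A #> b" if "U \<in> kernel (G Mod A) (G Mod B) \<theta>" for U
  proof -
    have U: "U \<in> carrier (G Mod A)" "\<theta> U = B"
      using that unfolding kernel_def by simp_all
    obtain x where x: "x \<in> carrier G" "U = A #> x" using cA[OF U(1)] by blast
    then have "B #> x = B" using U(2) \<theta> by simp
    then have "x \<in> B" using coset_eq_iff[OF subB x(1)] by simp
    then show ?thesis using x(2) by blast
  qed
  interpret tidy_extension "G Mod A" "G Mod B" \<theta> p
  proof unfold_locales
    show "finite (carrier (G Mod A))"
      using fin by (simp add: FactGroup_def RCOSETS_def)
    show "\<theta> ` carrier (G Mod A) = carrier (G Mod B)"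
    proof
      show "carrier (G Mod B) \<subseteq> \<theta> ` carrier (G Mod A)"
        using cB \<theta> a.hom_closed by (metis image_eqI subsetI)
    qed auto
  next
    fix U V assume "U \<in> kernel (G Mod A) (G Mod B) \<theta>" "V \<in> kernel (G Mod A) (G Mod B) \<theta>"
    then obtain x y where xy: "x \<in> B" "y \<in> B" "U = A #> x" "V = A #> y" using ker by blast
    show "U \<otimes>\<^bsub>G Mod A\<^esub> V = V \<otimes>\<^bsub>G Mod A\<^esub> U"
      unfolding xy(3,4) a.hom_mult[OF xy(1,2)[THEN subgroup.mem_carrier[OF subB]], symmetric]
        a.hom_mult[OF xy(2,1)[THEN subgroup.mem_carrier[OF subB]], symmetric]
      by (rule comm[OF xy(1,2)])
  next
    fix U assume "U \<in> kernel (G Mod A) (G Mod B) \<theta>"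
    then obtain x where x: "x \<in> B" "U = A #> x" using ker by blast
    then have "A #> (x [^] p) = A"
      by (intro coset_join2 subA exp nat_pow_closed subgroup.mem_carrier[OF subB])
    then show "U [^]\<^bsub>G Mod A\<^esub> p = \<one>\<^bsub>G Mod A\<^esub>"
      using x a.hom_nat_pow[of x p] subgroup.mem_carrier[OF subB] by (simp add: FactGroup_def)
  qed (fact tidy p)+
  show ?thesis by (rule tidy_image)
qed

end

theorem theorem2:
  fixes G :: "('a, 'b) monoid_scheme" and N :: "'a set"
  assumes "group G"
    and "finite (carrier G)"
    and "solvable G"
    and "tidy G"
    and "N \<lhd> G"
  shows "tidy (G Mod N)"
proof -
  interpret group G by fact
  \<comment> \<open>A maximal member of \<open>S\<close> must be \<open>N\<close>: a smaller one could be enlarged by one step.\<close>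
  define S where "S = {A. A \<lhd> G \<and> A \<subseteq> N \<and> tidy (G Mod A)}"
  have finN: "finite N"
    using assms(2,5) by (metis finite_subset normal_imp_subgroup subgroup.subset)
  have "finite S"
    by (rule finite_subset[of _ "Pow N"]) (use finN in \<open>auto simp: S_def\<close>)
  moreover have "{\<one>\<^bsub>G\<^esub>} \<in> S"
    unfolding S_def using one_is_normal tidy_Mod_trivial[OF assms(2,4)]
      subgroup.one_closed[OF normal_imp_subgroup[OF assms(5)]] by auto
  ultimately obtain A where A: "A \<in> S" "\<And>B. B \<in> S \<Longrightarrow> A \<subseteq> B \<Longrightarrow> A = B"
    using finite_has_maximal[of S] by blast
  have "A = N"
  proof (rule ccontr)
    assume "A \<noteq> N"
    then have AN: "A \<subset> N" and A': "A \<lhd> G" "tidy (G Mod A)" using A(1) unfolding S_def by auto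
    obtain p B where p: "Factorial_Ring.prime (p :: nat)" and B: "B \<lhd> G" "A \<subset> B" "B \<subseteq> N"
      and el: "\<And>b. b \<in> B \<Longrightarrow> b [^]\<^bsub>G\<^esub> p \<in> A"
        "\<And>b c. b \<in> B \<Longrightarrow> c \<in> B \<Longrightarrow> A #>\<^bsub>G\<^esub> (b \<otimes>\<^bsub>G\<^esub> c) = A #>\<^bsub>G\<^esub> (c \<otimes>\<^bsub>G\<^esub> b)"
      using elementary_abelian_section[OF assms(2,3) A'(1) assms(5) AN] by metis
    have "tidy (G Mod B)"
      by (rule tidy_Mod_step[OF assms(2) p A'(1) B(1) _ A'(2) el]) (use B(2) in blast)+
    then have "B \<in> S" unfolding S_def using B by blast
    then show False using A(2) B(2) by blast
  qed
  then show ?thesis using A(1) unfolding S_def by blast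
qed

end
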